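(* Let $T>1$ and $N\ge 1$ be integers, let $\rho_i:\mathbb R\to\mathbb R^+$ and $\phi_i:\mathbb R^N\to\mathbb R^N$ ($i=1,2,3,4$), and let $F,G,H:\mathbb Z\times\mathbb R^N\times\mathbb R^N\to\mathbb R$. Assume: ($\rho$) each $\rho_i$ is $T$-periodic and $\min_{t\in\mathbb Z[1,T]}\rho_i(t)>0$, $i=1,2,3,4$; (A1) each $\phi_i$ is a homeomorphism of $\mathbb R^N$ onto $\mathbb R^N$ with $\phi_i(0)=0$ and $\phi_i=\nabla\Phi_i$, where $\Phi_i\in C^1(\mathbb R^N,[0,+\infty))$ is strictly convex and $\Phi_i(0)=0$, $i=1,2,3,4$; (A2) $F,G,H$ are $T$-periodic in $t$ for all $(x_1,x_2)\in\mathbb R^N\times\mathbb R^N$ and continuously differentiable in $(x_1,x_2)$ for every $t\in\mathbb Z[1,T]$; for $\lambda,\nu\in\mathbb R$ put $W(t,x_1,x_2)=F(t,x_1,x_2)-\lambda G(t,x_1,x_2)+\nu H(t,x_1,x_2)$; (A3) there exist positive constants $c_i$ ($i=1,2,3,4$) and $\theta>1$ such that $(\phi_i(x)-\phi_i(y),x-y)\ge c_i|x-y|^\theta$ for all $x,y\in\mathbb R^N$, $i=1,2,3,4$; (A4) $\lim_{|x|\to\infty}\Phi_i(x)=+\infty$ and there exist positive constants $l\ge\theta$, $d_i$ and $m_i$ such that $\Phi_i(x)\le d_i|x|^l+m_i$ for all $x\in\mathbb R^N$, $i=1,2,3,4$; (A5)$'$ there exists $s>l$ such that for every $t\in\mathbb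 Z[1,T]$, $$\lim_{|x_1|+|x_2|\to\infty}\frac{F(t,x_1,x_2)}{|x_1|^l+|x_2|^l}=+\infty,\quad \lim_{|x_1|+|x_2|\to\infty}\frac{F(t,x_1,x_2)}{|x_1|^s+|x_2|^s}<+\infty,\quad \lim_{|x_1|+|x_2|\to\infty}\frac{G(t,x_1,x_2)}{|x_1|^s+|x_2|^s}=+\infty;$$ (A6) $\sum_{t=1}^TG(t,0,0)=0$. Let $E$, $\|\cdot\|$, $I,\Psi,\Phi$, $\mu^*(I,\Psi,\Phi,r)$ and $\beta(\mu I+\Psi,\Phi,r)$ be as defined in the context. Then for each $r>0$, for each $\mu>\max\{0,\mu^*(I,\Psi,\Phi,r)\}$, and for each compact interval $[a,b]\subset\,]0,\beta(\mu I+\Psi,\Phi,r)[$, there exists a number $\rho>0$ with the following property: for every $\lambda\in[a,b]$ there exists $\delta>0$ such that, for each $\nu\in[0,\delta]$, the system $$\begin{cases}\mu\Delta\big[\rho_1(t-1)\phi_1(\Delta u_1(t-1))\big]-\mu\rho_3(t)\phi_3(u_1(t))+\nabla_{u_1}W(t,u_1(t),u_2(t))=0\\ \mu\Delta\big[\rho_2(t-1)\phi_2(\Delta u_2(t-1))\big]-\mu\rho_4(t)\phi_4(u_2(t))+\nabla_{u_2}W(t,u_1(t),u_2(t))=0\end{cases}\qquad(t\in\mathbb Z)$$ has at least three $T$-periodic solutions $u=(u_1,u_2)\in E$ whose norms $\|u\|$ are less than $\rho$.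
   Context: Notation: $\mathbb Z[a,b]=\{a,a+1,\dots,b\}$ for integers $a<b$; $\Delta u(t)=u(t+1)-u(t)$ is the forward difference; $(\cdot,\cdot)$ and $|\cdot|$ are the usual inner product and norm on $\mathbb R^N$; $]c,d[$ denotes an open interval. Space: $E_T=\{h=\{h(t)\}_{t\in\mathbb Z}: h(t)\in\mathbb R^N,\ h(t+T)=h(t)\ \forall t\in\mathbb Z\}$ with norm $\|h\|_{E_T}=\big(\sum_{t=1}^T|\Delta h(t)|^\theta+\sum_{t=1}^T|h(t)|^\theta\big)^{1/\theta}$, where $\theta$ is the constant of (A3); $E=E_T\times E_T$ with norm $\|u\|=\|u_1\|_{E_T}+\|u_2\|_{E_T}$ for $u=(u_1,u_2)$. Functionals on $E$: $$I(u)=\sum_{t=1}^T\big[\rho_1(t)\Phi_1(\Delta u_1(t))+\rho_2(t)\Phi_2(\Delta u_2(t))+\rho_3(t)\Phi_3(u_1(t))+\rho_4(t)\Phi_4(u_2(t))\big],$$ $$\Psi(u)=-\sum_{t=1}^TF(t,u_1(t),u_2(t)),\qquad \Phi(u)=\sum_{t=1}^TG(t,u_1(t),u_2(t)).$$ For $r>0$: $$\gamma=\inf_{u\in E}(\Psi(u)+\Phi(u)),\qquad \eta_r=\inf_{u\in\Phi^{-1}(r)}I(u),$$ $$\mu^*(I,\Psi,\Phi,r)=\inf\Big\{\frac{\Psi(u)-\gamma+r}{\eta_r-I(u)}:\ u\in E,\ \Phi(u)<r,\ I(u)<\eta_r\Big\},$$ $$\beta(\mu I+\Psi,\Phi,r)=\sup_{u\in\Phi^{-1}(]r,+\infty[)}\frac{\mu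 I(u)+\Psi(u)-\inf_{\Phi^{-1}(]-\infty,r])}(\mu I+\Psi)}{r-\Phi(u)}.$$ *)

theory Defs
  imports "HOL-Analysis.Analysis"
begin

definition grad :: "('a::real_inner \<Rightarrow> real) \<Rightarrow> 'a \<Rightarrow> 'a" where
  "grad f x = (THE D. GDERIV f x :> D)"

definition C1_fun :: "('a::real_inner \<Rightarrow> real) \<Rightarrow> bool" where
  "C1_fun f \<longleftrightarrow> (\<exists>g. (\<forall>x. GDERIV f x :> g x) \<and> continuous_on UNIV g)"

definition strictly_convex :: "('a::real_vector \<Rightarrow> real) \<Rightarrow> bool" where
  "strictly_convex f \<longleftrightarrow> (\<forall>x y. \<forall>s\<in>{0<..<1}. x \<noteq> y \<longrightarrow>
     f ((1 - s) *\<^sub>R x + s *\<^sub>R y) < (1 - s) * f x + s * f y)"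

definition norm_sum_infinity :: "('a::real_normed_vector \<times> 'b::real_normed_vector) filter" where
  "norm_sum_infinity = filtercomap (\<lambda>(x, y). norm x + norm y) at_top"

definition fdiff :: "(int \<Rightarrow> 'a::ab_group_add) \<Rightarrow> int \<Rightarrow> 'a" where
  "fdiff u t = u (t + 1) - u t"

type_synonym 'n seq = "int \<Rightarrow> real ^ 'n"

definition ET :: "int \<Rightarrow> 'n::finite seq set" where
  "ET T = {h. \<forall>t. h (t + T) = h t}"

definition norm_ET :: "int \<Rightarrow> real \<Rightarrow> 'n::finite seq \<Rightarrow> real" where
  "norm_ET T \<theta> h =
     ((\<Sum>t=1..T. norm (fdiff h t) powr \<theta>) + (\<Sum>t=1..T. norm (h t) powr \<theta>)) powr (1 / \<theta>)"

definition E_space :: "int \<Rightarrow> ('n::finite seq \<times> 'n seq) set" where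
  "E_space T = ET T \<times> ET T"

definition norm_E :: "int \<Rightarrow> real \<Rightarrow> 'n::finite seq \<times> 'n seq \<Rightarrow> real" where
  "norm_E T \<theta> u = norm_ET T \<theta> (fst u) + norm_ET T \<theta> (snd u)"

definition I_fun ::
  "int \<Rightarrow> (nat \<Rightarrow> real \<Rightarrow> real) \<Rightarrow> (nat \<Rightarrow> real ^ 'n \<Rightarrow> real) \<Rightarrow> 'n::finite seq \<times> 'n seq \<Rightarrow> real" where
  "I_fun T \<rho> P u = (\<Sum>t=1..T.
       \<rho> 1 (of_int t) * P 1 (fdiff (fst u) t)
     + \<rho> 2 (of_int t) * P 2 (fdiff (snd u) t)
     + \<rho> 3 (of_int t) * P 3 (fst u t)
     + \<rho> 4 (of_int t) * P 4 (snd u t))"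

definition Psi_fun ::
  "int \<Rightarrow> (int \<Rightarrow> real ^ 'n \<Rightarrow> real ^ 'n \<Rightarrow> real) \<Rightarrow> 'n::finite seq \<times> 'n seq \<Rightarrow> real" where
  "Psi_fun T F u = - (\<Sum>t=1..T. F t (fst u t) (snd u t))"

definition Phi_fun ::
  "int \<Rightarrow> (int \<Rightarrow> real ^ 'n \<Rightarrow> real ^ 'n \<Rightarrow> real) \<Rightarrow> 'n::finite seq \<times> 'n seq \<Rightarrow> real" where
  "Phi_fun T G u = (\<Sum>t=1..T. G t (fst u t) (snd u t))"

(* All infima and suprema are taken in the extended reals, so that no default value
   of Inf or Sup on the reals (empty or unbounded sets) can enter. *)

definition gamma_inf :: "'a set \<Rightarrow> ('a \<Rightarrow> real) \<Rightarrow> ('a \<Rightarrow> real) \<Rightarrow> ereal" where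
  "gamma_inf E \<Psi> \<Phi> = (INF u\<in>E. ereal (\<Psi> u + \<Phi> u))"

definition eta :: "'a set \<Rightarrow> ('a \<Rightarrow> real) \<Rightarrow> ('a \<Rightarrow> real) \<Rightarrow> real \<Rightarrow> ereal" where
  "eta E I \<Phi> r = (INF u\<in>{u\<in>E. \<Phi> u = r}. ereal (I u))"

definition mu_star ::
  "'a set \<Rightarrow> ('a \<Rightarrow> real) \<Rightarrow> ('a \<Rightarrow> real) \<Rightarrow> ('a \<Rightarrow> real) \<Rightarrow> real \<Rightarrow> ereal" where
  "mu_star E I \<Psi> \<Phi> r =
     (INF u\<in>{u\<in>E. \<Phi> u < r \<and> ereal (I u) < eta E I \<Phi> r}.
        (ereal (\<Psi> u) - gamma_inf E \<Psi> \<Phi> + ereal r) / (eta E I \<Phi> r - ereal (I u)))"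

definition beta :: "'a set \<Rightarrow> ('a \<Rightarrow> real) \<Rightarrow> ('a \<Rightarrow> real) \<Rightarrow> real \<Rightarrow> ereal" where
  "beta E J \<Phi> r =
     (SUP u\<in>{u\<in>E. \<Phi> u > r}.
        (ereal (J u) - (INF v\<in>{v\<in>E. \<Phi> v \<le> r}. ereal (J v))) / ereal (r - \<Phi> u))"

definition W_fun ::
  "(int \<Rightarrow> 'x \<Rightarrow> 'x \<Rightarrow> real) \<Rightarrow> (int \<Rightarrow> 'x \<Rightarrow> 'x \<Rightarrow> real) \<Rightarrow> (int \<Rightarrow> 'x \<Rightarrow> 'x \<Rightarrow> real)
     \<Rightarrow> real \<Rightarrow> real \<Rightarrow> int \<Rightarrow> 'x \<Rightarrow> 'x \<Rightarrow> real" where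
  "W_fun F G H l n t x y = F t x y - l * G t x y + n * H t x y"

definition solves_system ::
  "(nat \<Rightarrow> real \<Rightarrow> real) \<Rightarrow> (nat \<Rightarrow> real ^ 'n \<Rightarrow> real ^ 'n) \<Rightarrow> real
     \<Rightarrow> (int \<Rightarrow> real ^ 'n \<Rightarrow> real ^ 'n \<Rightarrow> real) \<Rightarrow> 'n::finite seq \<times> 'n seq \<Rightarrow> bool" where
  "solves_system \<rho> \<phi> \<mu> W u \<longleftrightarrow> (\<forall>t.
       \<mu> *\<^sub>R fdiff (\<lambda>s. \<rho> 1 (of_int (s - 1)) *\<^sub>R \<phi> 1 (fdiff (fst u) (s - 1))) t
         - (\<mu> * \<rho> 3 (of_int t)) *\<^sub>R \<phi> 3 (fst u t)
         + grad (\<lambda>x. W t x (snd u t)) (fst u t) = 0 \<and>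
       \<mu> *\<^sub>R fdiff (\<lambda>s. \<rho> 2 (of_int (s - 1)) *\<^sub>R \<phi> 2 (fdiff (snd u) (s - 1))) t
         - (\<mu> * \<rho> 4 (of_int t)) *\<^sub>R \<phi> 4 (snd u t)
         + grad (\<lambda>y. W t (fst u t) y) (snd u t) = 0)"

end

theory Submission
  imports Defs
begin

text \<open>
  Periodic solutions are the critical points of \<open>f = \<mu> I + \<Psi> + \<lambda> \<Phi> - \<nu> \<Sum> H\<close> on the space of periodic
  sequences. The condition on \<open>\<mu>\<close> yields a point \<open>u\<^sub>0\<close> with \<open>\<Phi> u\<^sub>0 < r\<close> at which \<open>J = \<mu> I + \<Psi>\<close> lies
  strictly below its values on \<open>{\<Phi> = r}\<close>; the condition on \<open>\<lambda>\<close> yields a point \<open>u\<^sub>1\<close> with \<open>\<Phi> u\<^sub>1 > r\<close>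
  and \<open>J u\<^sub>1 + \<lambda> (\<Phi> u\<^sub>1 - r) \<le> J u\<^sub>0\<close>. Hence \<open>{\<Phi> = r}\<close> is a barrier for \<open>f\<close>, with a local minimum on either
  side, and a mountain pass point between these is the third solution. Since \<open>J + \<lambda> \<Phi>\<close> is coercive,
  uniformly for \<open>\<lambda>\<close> in a compact subinterval of the positive reals, everything happens in one fixed
  compact set, on which \<open>\<nu> \<Sum> H\<close> is a small perturbation.

  The mountain pass level is taken over compact connected sets instead of paths, and the gradient
  flow is replaced by a single Euler step \<open>x - \<sigma> \<nabla>f(x)\<close>: it is continuous, fixes critical points, and
  lowers \<open>f\<close> by about \<open>\<sigma> |\<nabla>f(x)|\<^sup>2\<close> uniformly on compact sets.
\<close>

section \<open>Mountain pass on compact sets\<close>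

text \<open>Tube lemma: the parameters in \<open>{0..1}\<close> with a bad point in \<open>K\<close>
  are the projection of a compact set, hence closed, and 0 is not among them. It supplies step
  lengths valid on a whole compact set.\<close>

lemma pos_near_zero_uniform:
  fixes k :: "real \<Rightarrow> 'x::t2_space \<Rightarrow> real"
  assumes K: "compact K" and k: "continuous_on UNIV (\<lambda>p. k (fst p) (snd p))"
    and pos: "\<And>x. x \<in> K \<Longrightarrow> k 0 x > 0"
  shows "\<exists>\<tau>>0. \<forall>\<sigma>\<in>{0..\<tau>}. \<forall>x\<in>K. k \<sigma> x > 0"
proof -
  define Z where "Z = ({0..1} \<times> K) \<inter> {p. k (fst p) (snd p) \<le> 0}"
  have "closed {p. k (fst p) (snd p) \<le> 0}"
    by (intro closed_Collect_le k continuous_on_const)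
  then have "compact Z"
    unfolding Z_def by (intro compact_Int_closed compact_Times K) auto
  then have "compact (fst ` Z)"
    by (intro compact_continuous_image continuous_on_fst continuous_on_id)
  then have "open (- (fst ` Z))"
    by (simp add: compact_imp_closed open_Compl)
  moreover have "0 \<notin> fst ` Z"
    using pos unfolding Z_def by force
  ultimately obtain e where e: "e > 0" "ball 0 e \<subseteq> - (fst ` Z)"
    by (metis ComplI openE)
  show ?thesis
  proof (intro exI[of _ "min 1 (e / 2)"] conjI ballI)
    fix \<sigma> x assume "\<sigma> \<in> {0..min 1 (e / 2)}" "x \<in> K"
    then have "\<sigma> \<in> ball 0 e" "\<sigma> \<in> {0..1}" using e by auto
    then have "(\<sigma>, x) \<notin> Z" using e(2) by force
    then show "k \<sigma> x > 0" using \<open>x \<in> K\<close> \<open>\<sigma> \<in> {0..1}\<close> by (auto simp: Z_def)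
  qed (use e in auto)
qed

text \<open>In the next lemmas \<open>E \<sigma>\<close> is the Euler step of length \<open>\<sigma>\<close> and \<open>q\<close> the squared norm of the gradient of \<open>f\<close>.\<close>

lemma mountain_pass_compact:
  fixes f q \<Phi> :: "'x::t2_space \<Rightarrow> real" and E :: "real \<Rightarrow> 'x \<Rightarrow> 'x"
  assumes D: "compact D"
    and f: "continuous_on UNIV f" and q: "continuous_on UNIV q" and \<Phi>: "continuous_on UNIV \<Phi>"
    and E: "\<And>\<sigma>. continuous_on UNIV (E \<sigma>)"
    and q_nonneg: "\<And>x. q x \<ge> 0"
    and descent: "\<And>\<epsilon>. \<epsilon> > 0 \<Longrightarrow>
      \<exists>\<tau>>0. \<forall>\<sigma>\<in>{0..\<tau>}. \<forall>x\<in>D. f (E \<sigma> x) \<le> f x - \<sigma> * (q x - \<epsilon>)"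
    and stay: "\<exists>\<tau>>0. \<forall>\<sigma>\<in>{0..\<tau>}. \<forall>x\<in>D. f x < L \<longrightarrow> E \<sigma> x \<in> D"
    and A: "compact A" "connected A" "A \<subseteq> D" "w0 \<in> A" "w1 \<in> A" "\<And>x. x \<in> A \<Longrightarrow> f x < L"
    and fixed: "\<And>\<sigma>. E \<sigma> w0 = w0" "\<And>\<sigma>. E \<sigma> w1 = w1"
    and sep: "\<Phi> w0 < r" "r < \<Phi> w1"
    and barrier: "\<And>x. x \<in> D \<Longrightarrow> \<Phi> x = r \<Longrightarrow> B \<le> f x"
  obtains x where "x \<in> D" "q x = 0" "B \<le> f x"
proof -
  \<comment> \<open>A continuous map that fixes \<open>w0\<close> and \<open>w1\<close> and sends a
    member into \<open>D\<close> yields another member; this is all that the minimax argument asks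
    of paths.\<close>
  define \<Gamma> where "\<Gamma> = {S. compact S \<and> connected S \<and> S \<subseteq> D \<and> w0 \<in> S \<and> w1 \<in> S}"
  define c where "c = Inf ((\<lambda>S. Sup (f ` S)) ` \<Gamma>)"
  have fcont: "continuous_on S f" for S
    using f continuous_on_subset by blast
  have sup_ub: "f x \<le> Sup (f ` S)" if "S \<in> \<Gamma>" "x \<in> S" for S x
    using that fcont unfolding \<Gamma>_def
    by (intro cSup_upper bounded_imp_bdd_above compact_imp_bounded compact_continuous_image) auto
  have B_le: "B \<le> Sup (f ` S)" if S: "S \<in> \<Gamma>" for S
  proof -
    \<comment> \<open>\<open>\<Phi>\<close> takes values on both sides of \<open>r\<close> on
      \<open>S\<close>, so \<open>S\<close> meets the barrier.\<close>
    have "connected (\<Phi> ` S)"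
      using S continuous_on_subset[OF \<Phi>] unfolding \<Gamma>_def by (intro connected_continuous_image) auto
    then have "r \<in> \<Phi> ` S"
      using sep S connectedD_interval[of "\<Phi> ` S" "\<Phi> w0" "\<Phi> w1" r] unfolding \<Gamma>_def by simp
    then obtain x where "x \<in> S" "\<Phi> x = r" by auto
    then show ?thesis
      using barrier[of x] sup_ub[OF S, of x] S unfolding \<Gamma>_def by force
  qed
  have "A \<in> \<Gamma>" using A unfolding \<Gamma>_def by auto
  have bdd: "bdd_below ((\<lambda>S. Sup (f ` S)) ` \<Gamma>)"
    using B_le by (intro bdd_belowI2[of _ B])
  have c_le: "c \<le> Sup (f ` S)" if "S \<in> \<Gamma>" for S
    unfolding c_def using bdd that by (intro cInf_lower) auto
  have "B \<le> c"
    unfolding c_def using \<open>A \<in> \<Gamma>\<close> B_le by (intro cInf_greatest) auto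
  have attained: "\<exists>x\<in>S. f x = Sup (f ` S)" if S: "S \<in> \<Gamma>" for S
  proof -
    have "compact S" "S \<noteq> {}" using S unfolding \<Gamma>_def by auto
    then obtain x where x: "x \<in> S" "\<forall>y\<in>S. f y \<le> f x"
      using continuous_attains_sup[OF _ _ fcont] by blast
    then have "Sup (f ` S) = f x"
      by (intro cSup_eq_maximum) auto
    then show ?thesis using x by metis
  qed
  have "c < L"
    using attained[OF \<open>A \<in> \<Gamma>\<close>] A(6) c_le[OF \<open>A \<in> \<Gamma>\<close>] by force
  have "\<exists>x\<in>D. q x = 0 \<and> f x = c"
  proof (rule ccontr)
    assume no: "\<not> ?thesis"
    have "D \<noteq> {}" using A by auto
    moreover have "continuous_on D (\<lambda>x. max \<bar>f x - c\<bar> (q x / 2))"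
      using q by (intro continuous_intros fcont) (auto intro: continuous_on_subset)
    ultimately obtain z where z: "z \<in> D"
      "\<And>x. x \<in> D \<Longrightarrow> max \<bar>f z - c\<bar> (q z / 2) \<le> max \<bar>f x - c\<bar> (q x / 2)"
      using continuous_attains_inf[OF D] by blast
    \<comment> \<open>On \<open>D\<close>, a value of \<open>f\<close> closer than \<open>e\<close> to \<open>c\<close> forces \<open>q \<ge> 2 e\<close>.\<close>
    define e where "e = max \<bar>f z - c\<bar> (q z / 2)"
    have "e > 0"
    proof (cases "f z = c")
      case True
      then have "q z > 0" using no z(1) q_nonneg[of z] by force
      then show ?thesis unfolding e_def by simp
    next
      case False
      then show ?thesis unfolding e_def by simp
    qed
    obtain \<tau>1 where \<tau>1: "\<tau>1 > 0" "\<And>\<sigma> x. \<sigma> \<in> {0..\<tau>1} \<Longrightarrow> x \<in> D \<Longrightarrow> f (E \<sigma> x) \<le> f x - \<sigma> * (q x - e)"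
      using descent[OF \<open>e > 0\<close>] by auto
    obtain \<tau>2 where \<tau>2: "\<tau>2 > 0" "\<And>\<sigma> x. \<sigma> \<in> {0..\<tau>2} \<Longrightarrow> x \<in> D \<Longrightarrow> f x < L \<Longrightarrow> E \<sigma> x \<in> D"
      using stay by auto
    define \<tau> where "\<tau> = min (1/2) (min \<tau>1 \<tau>2)"
    have \<tau>: "\<tau> > 0" "\<tau> \<le> 1/2" "\<tau> \<in> {0..\<tau>1}" "\<tau> \<in> {0..\<tau>2}"
      using \<tau>1(1) \<tau>2(1) unfolding \<tau>_def by auto
    \<comment> \<open>A set with maximum below \<open>c + h\<close> has \<open>f < L\<close>
      throughout, so its Euler step stays in \<open>D\<close>; and \<open>h\<close> is at most half
      the descent \<open>e * \<tau>\<close> guaranteed where \<open>q \<ge> 2 * e\<close>.\<close>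
    define h where "h = min (L - c) (e * \<tau> / 2)"
    have "e * \<tau> > 0" using \<open>e > 0\<close> \<tau> by simp
    then have h: "h > 0" "h \<le> L - c" "h \<le> e * \<tau> / 2"
      using \<open>c < L\<close> unfolding h_def by linarith+
    have "e * \<tau> \<le> e / 2" using \<tau>(2) \<open>e > 0\<close> by (simp add: mult_left_mono[of \<tau> "1/2" e, simplified])
    obtain S where S: "S \<in> \<Gamma>" "Sup (f ` S) < c + h"
      using cInf_lessD[of "(\<lambda>S. Sup (f ` S)) ` \<Gamma>" "c + h"] \<open>A \<in> \<Gamma>\<close> h(1) unfolding c_def by auto
    have lt: "f x < c + h" "x \<in> D" if "x \<in> S" for x
      using sup_ub[OF S(1) that] S that unfolding \<Gamma>_def by auto
    have "E \<tau> ` S \<in> \<Gamma>"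
    proof -
      have "E \<tau> ` S \<subseteq> D"
      proof
        fix y assume "y \<in> E \<tau> ` S"
        then obtain x where x: "x \<in> S" "y = E \<tau> x" by blast
        show "y \<in> D"
          unfolding x(2) using \<tau>2(2)[OF \<tau>(4) lt(2)[OF x(1)]] lt(1)[OF x(1)] h(2) by linarith
      qed
      moreover have "w0 \<in> E \<tau> ` S" "w1 \<in> E \<tau> ` S"
        using S(1) imageI[of w0 S "E \<tau>"] imageI[of w1 S "E \<tau>"] unfolding \<Gamma>_def fixed by auto
      moreover have "continuous_on S (E \<tau>)"
        using E continuous_on_subset by blast
      ultimately show ?thesis
        using S(1) compact_continuous_image[of S "E \<tau>"] connected_continuous_image[of S "E \<tau>"]
        unfolding \<Gamma>_def by simp
    qed
    then obtain y where y: "y \<in> S" "f (E \<tau> y) \<ge> c"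
      using attained[of "E \<tau> ` S"] c_le[of "E \<tau> ` S"] by (metis imageE)
    have step: "f (E \<tau> y) \<le> f y - \<tau> * (q y - e)"
      using \<tau>1(2) \<tau>(3) lt(2)[OF y(1)] by blast
    show False
    proof (cases "q y < 2 * e")
      \<comment> \<open>Here \<open>f y\<close> is at distance at least \<open>e\<close> from
        \<open>c\<close>, and being less than \<open>c + e / 4\<close> it must lie below. The step
        raises \<open>f\<close> by at most \<open>\<tau> * e \<le> e / 2\<close>, too little to
        reach \<open>c\<close>.\<close>
      case True
      then have "\<bar>f y - c\<bar> \<ge> e"
        using z(2)[OF lt(2)[OF y(1)], folded e_def] by (auto simp: le_max_iff_disj)
      then have "f y \<le> c - e"
        using lt(1)[OF y(1)] h \<open>e * \<tau> \<le> e / 2\<close> \<open>e > 0\<close> by linarith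
      moreover have "\<tau> * q y \<ge> 0" using q_nonneg \<tau> by simp
      ultimately show False
        using step y(2) \<open>e * \<tau> \<le> e / 2\<close> \<open>e > 0\<close> unfolding right_diff_distrib mult.commute[of \<tau> e] by linarith
    next
      \<comment> \<open>The step lowers \<open>f\<close> by at least
        \<open>\<tau> * e \<ge> 2 * h\<close> and so ends below \<open>c\<close>.\<close>
      case False
      then have "\<tau> * e \<le> \<tau> * (q y - e)" using \<tau> by (intro mult_left_mono) auto
      then show False
        using step y(2) lt(1)[OF y(1)] h \<open>e * \<tau> > 0\<close> by (simp add: mult.commute)
    qed
  qed
  then show thesis using that \<open>B \<le> c\<close> by auto
qed

text \<open>The constraint holds strictly at \<open>w\<close>, so short Euler steps from
  \<open>w\<close> respect it. If \<open>q w\<close> were positive, such a step of length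
  \<open>\<tau>\<close> would lower \<open>f\<close> by at least \<open>\<tau> * q w / 2\<close>,
  against minimality.\<close>

lemma constrained_minimum_critical:
  fixes f q \<Phi> :: "'x::t2_space \<Rightarrow> real" and E :: "real \<Rightarrow> 'x \<Rightarrow> 'x"
  assumes \<Phi>: "continuous_on UNIV \<Phi>"
    and E: "continuous_on UNIV (\<lambda>p. E (fst p) (snd p))" "\<And>x. E 0 x = x"
    and q_nonneg: "\<And>x. q x \<ge> 0"
    and descent: "\<And>\<epsilon>. \<epsilon> > 0 \<Longrightarrow>
      \<exists>\<tau>>0. \<forall>\<sigma>\<in>{0..\<tau>}. \<forall>x\<in>D. f (E \<sigma> x) \<le> f x - \<sigma> * (q x - \<epsilon>)"
    and stay: "\<exists>\<tau>>0. \<forall>\<sigma>\<in>{0..\<tau>}. \<forall>x\<in>D. f x < L \<longrightarrow> E \<sigma> x \<in> D"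
    and w: "w \<in> D" "f w < L" "\<Phi> w < r"
    and min: "\<And>x. x \<in> D \<Longrightarrow> \<Phi> x \<le> r \<Longrightarrow> f w \<le> f x"
  shows "q w = 0"
proof (rule ccontr)
  assume "q w \<noteq> 0"
  with q_nonneg[of w] have pos: "q w / 2 > 0" by simp
  have "continuous_on UNIV (\<lambda>p. \<Phi> (E (fst p) (snd p)))"
    by (rule continuous_on_compose2[OF \<Phi> E(1)]) auto
  then have "continuous_on UNIV (\<lambda>p. r - \<Phi> (E (fst p) (snd p)))"
    by (intro continuous_intros)
  then obtain \<tau>0 where \<tau>0: "\<tau>0 > 0" "\<And>\<sigma>. \<sigma> \<in> {0..\<tau>0} \<Longrightarrow> r - \<Phi> (E \<sigma> w) > 0"
    using pos_near_zero_uniform[of "{w}" "\<lambda>\<sigma> x. r - \<Phi> (E \<sigma> x)"] E(2) w(3) by auto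
  obtain \<tau>1 where \<tau>1: "\<tau>1 > 0" "\<And>\<sigma> x. \<sigma> \<in> {0..\<tau>1} \<Longrightarrow> x \<in> D \<Longrightarrow> f (E \<sigma> x) \<le> f x - \<sigma> * (q x - q w / 2)"
    using descent[OF pos] by auto
  obtain \<tau>2 where \<tau>2: "\<tau>2 > 0" "\<And>\<sigma> x. \<sigma> \<in> {0..\<tau>2} \<Longrightarrow> x \<in> D \<Longrightarrow> f x < L \<Longrightarrow> E \<sigma> x \<in> D"
    using stay by auto
  define \<tau> where "\<tau> = min \<tau>0 (min \<tau>1 \<tau>2)"
  have \<tau>: "\<tau> > 0" "\<tau> \<in> {0..\<tau>0}" "\<tau> \<in> {0..\<tau>1}" "\<tau> \<in> {0..\<tau>2}"
    using \<tau>0(1) \<tau>1(1) \<tau>2(1) unfolding \<tau>_def by auto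
  have "f w \<le> f (E \<tau> w)"
    using min[OF \<tau>2(2)[OF \<tau>(4) w(1,2)]] \<tau>0(2)[OF \<tau>(2)] by linarith
  moreover have "f (E \<tau> w) \<le> f w - \<tau> * (q w - q w / 2)"
    using \<tau>1(2) \<tau> w by blast
  moreover have "\<tau> * (q w - q w / 2) > 0"
    using \<tau>(1) pos by simp
  ultimately show False by linarith
qed

text \<open>\<open>A\<close> contains the part of \<open>D\<close> with \<open>f < B\<close>, where
  the minima on the two sides of the barrier are found. Being connected, with \<open>f < L\<close>
  on it, it is also a competitor in the mountain pass between them. The third point is new because
  its value is at least \<open>B\<close>.\<close>

lemma three_critical_points_compact:
  fixes f q \<Phi> :: "'x::t2_space \<Rightarrow> real" and E :: "real \<Rightarrow> 'x \<Rightarrow> 'x"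
  assumes D: "compact D"
    and f: "continuous_on UNIV f" and q: "continuous_on UNIV q" and \<Phi>: "continuous_on UNIV \<Phi>"
    and E: "continuous_on UNIV (\<lambda>p. E (fst p) (snd p))" "\<And>x. E 0 x = x"
    and q_nonneg: "\<And>x. q x \<ge> 0"
    and fixed: "\<And>\<sigma> x. x \<in> D \<Longrightarrow> q x = 0 \<Longrightarrow> E \<sigma> x = x"
    and descent: "\<And>\<epsilon>. \<epsilon> > 0 \<Longrightarrow>
      \<exists>\<tau>>0. \<forall>\<sigma>\<in>{0..\<tau>}. \<forall>x\<in>D. f (E \<sigma> x) \<le> f x - \<sigma> * (q x - \<epsilon>)"
    and stay: "\<exists>\<tau>>0. \<forall>\<sigma>\<in>{0..\<tau>}. \<forall>x\<in>D. f x < L \<longrightarrow> E \<sigma> x \<in> D"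
    and A: "compact A" "connected A" "A \<subseteq> D" "\<And>x. x \<in> A \<Longrightarrow> f x < L"
      "\<And>x. x \<in> D \<Longrightarrow> f x < B \<Longrightarrow> x \<in> A"
    and u0: "u0 \<in> D" "\<Phi> u0 < r" "f u0 < B" and u1: "u1 \<in> D" "r < \<Phi> u1" "f u1 < B"
    and barrier: "\<And>x. x \<in> D \<Longrightarrow> \<Phi> x = r \<Longrightarrow> B \<le> f x"
  shows "\<exists>S \<subseteq> {x \<in> D. q x = 0}. card S = 3"
proof -
  \<comment> \<open>Stated for arbitrary \<open>\<psi>\<close>, since it serves
    \<open>\<Phi>\<close> below \<open>r\<close> and \<open>- \<Phi>\<close> below
    \<open>- r\<close>.\<close>
  have side: "\<exists>w\<in>A. \<psi> w < \<rho> \<and> q w = 0 \<and> f w < B"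
    if \<psi>: "continuous_on UNIV \<psi>" and u: "u \<in> D" "\<psi> u < \<rho>" "f u < B"
      and bar: "\<And>x. x \<in> D \<Longrightarrow> \<psi> x = \<rho> \<Longrightarrow> B \<le> f x" for \<psi> :: "'x \<Rightarrow> real" and \<rho> u
  proof -
    have "closed {x. \<psi> x \<le> \<rho>}"
      by (intro closed_Collect_le \<psi> continuous_on_const)
    then have "compact (D \<inter> {x. \<psi> x \<le> \<rho>})"
      using D by (intro compact_Int_closed)
    moreover have "u \<in> D \<inter> {x. \<psi> x \<le> \<rho>}" using u by simp
    moreover have "continuous_on (D \<inter> {x. \<psi> x \<le> \<rho>}) f"
      using f continuous_on_subset by blast
    ultimately obtain w where w: "w \<in> D" "\<psi> w \<le> \<rho>" "\<And>x. x \<in> D \<Longrightarrow> \<psi> x \<le> \<rho> \<Longrightarrow> f w \<le> f x"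
      using continuous_attains_inf[of "D \<inter> {x. \<psi> x \<le> \<rho>}" f] by blast
    \<comment> \<open>The minimum is no higher than the value at \<open>u\<close>, so it cannot sit
      on the barrier.\<close>
    have "f w < B" using w(3)[of u] u by linarith
    then have "\<psi> w < \<rho>" using bar[of w] w by force
    moreover have "w \<in> A" using A(5) w \<open>f w < B\<close> by blast
    moreover have "q w = 0"
      using constrained_minimum_critical[OF \<psi> E q_nonneg descent stay w(1) _ \<open>\<psi> w < \<rho>\<close>]
        A(4) \<open>w \<in> A\<close> w by blast
    ultimately show ?thesis using \<open>f w < B\<close> by blast
  qed
  obtain w0 where w0: "w0 \<in> A" "\<Phi> w0 < r" "q w0 = 0" "f w0 < B"
    using side[OF \<Phi> u0] barrier by blast
  have "\<exists>w\<in>A. - \<Phi> w < - r \<and> q w = 0 \<and> f w < B"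
    using u1 barrier by (intro side[where u = u1]) (auto intro: continuous_intros \<Phi>)
  then obtain w1 where w1: "w1 \<in> A" "r < \<Phi> w1" "q w1 = 0" "f w1 < B"
    by auto
  have E\<sigma>: "continuous_on UNIV (E \<sigma>)" for \<sigma>
    using continuous_on_compose2[OF E(1), of UNIV "\<lambda>x. (\<sigma>, x)"] by (simp add: continuous_intros)
  obtain w2 where w2: "w2 \<in> D" "q w2 = 0" "B \<le> f w2"
    using mountain_pass_compact[OF D f q \<Phi> E\<sigma> q_nonneg descent stay A(1-3) w0(1) w1(1) A(4) _ _ w0(2) w1(2) barrier]
      fixed w0 w1 A(3) by blast
  show ?thesis
  proof (intro exI conjI)
    show "{w0, w1, w2} \<subseteq> {x \<in> D. q x = 0}" using w0 w1 w2 A(3) by auto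
    show "card {w0, w1, w2} = 3"
      using w0 w1 w2 by (auto simp: card_insert_if)
  qed
qed

section \<open>Actions of periodic sequences\<close>

text \<open>The type of values carries no structure, so this also describes periodic families of
  functions such as \<open>\<kappa>\<close> or \<open>F\<close>.\<close>

definition periodic_seqs :: "int \<Rightarrow> (int \<Rightarrow> 'v) set" where
  "periodic_seqs T = {x. \<forall>t. x (t + T) = x t}"

definition periodic_box :: "int \<Rightarrow> real \<Rightarrow> (int \<Rightarrow> 'v::real_normed_vector) set" where
  "periodic_box T R = {x \<in> periodic_seqs T. \<forall>t. norm (x t) \<le> R}"

definition action :: "int \<Rightarrow> (int \<Rightarrow> 'v::ab_group_add \<Rightarrow> real) \<Rightarrow> (int \<Rightarrow> 'v \<Rightarrow> real) \<Rightarrow> (int \<Rightarrow> 'v) \<Rightarrow> real" where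
  "action T K V x = (\<Sum>t=1..T. K t (fdiff x t) + V t (x t))"

text \<open>For \<open>\<kappa>\<close> and \<open>v\<close> the gradients of \<open>K\<close> and
  \<open>V\<close>, this is the gradient of the action with respect to the inner product summed over
  one period. Its vanishing is the discrete Euler-Lagrange equation.\<close>

definition action_grad :: "(int \<Rightarrow> 'v \<Rightarrow> 'v) \<Rightarrow> (int \<Rightarrow> 'v \<Rightarrow> 'v) \<Rightarrow> (int \<Rightarrow> 'v) \<Rightarrow> int \<Rightarrow> 'v::ab_group_add" where
  "action_grad \<kappa> v x t = \<kappa> (t - 1) (fdiff x (t - 1)) - \<kappa> t (fdiff x t) + v t (x t)"

section \<open>Periodicity and summation by parts\<close>

lemma periodic_representative:
  fixes T :: int
  assumes "T > 0"
  obtains k where "t + k * T \<in> {1..T}"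
proof
  show "t + (- ((t - 1) div T)) * T \<in> {1..T}"
    using pos_mod_sign[OF assms, of "t - 1"] pos_mod_bound[OF assms, of "t - 1"]
      div_mult_mod_eq[of "t - 1" T] unfolding atLeastAtMost_iff by linarith
qed

lemma periodic_shift:
  fixes T :: int
  assumes "x \<in> periodic_seqs T"
  shows "x (t + k * T) = x t"
proof (induction k rule: int_induct[of _ 0])
  case (step1 i)
  then have "x (t + i * T + T) = x t" using assms by (simp add: periodic_seqs_def)
  then show ?case by (simp add: algebra_simps)
next
  case (step2 i)
  have "x (t + (i - 1) * T + T) = x (t + (i - 1) * T)" using assms by (simp add: periodic_seqs_def)
  with step2 show ?case by (simp add: algebra_simps)
qed simp

lemma periodic_all_iff:
  fixes T :: int
  assumes "T > 0" "x \<in> periodic_seqs T"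
  shows "(\<forall>t. Q (x t)) \<longleftrightarrow> (\<forall>t\<in>{1..T}. Q (x t))"
  using periodic_representative[OF assms(1)] periodic_shift[OF assms(2)] by metis

text \<open>Moving the window of summation back by one exchanges the term at \<open>T\<close> for
  the term at 0.\<close>

lemma sum_periodic_pred:
  fixes T :: int and k :: "int \<Rightarrow> 'a::ab_group_add"
  assumes "T > 0" "k T = k 0"
  shows "(\<Sum>t=1..T. k (t - 1)) = (\<Sum>t=1..T. k t)"
proof -
  have "(\<Sum>t=1..T. k (t - 1)) = sum k {0..T - 1}"
    by (rule sum.reindex_bij_witness[of _ "\<lambda>t. t + 1" "\<lambda>t. t - 1"]) auto
  also have "\<dots> = k 0 + sum k {1..T - 1}"
    using assms(1) by (subst simp_from_to) auto
  also have "\<dots> = sum k {1..T}"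
  proof -
    have "{1..T} = insert T {1..T - 1}" using assms(1) by auto
    then show ?thesis using assms(2) by simp
  qed
  finally show ?thesis .
qed

lemma sum_by_parts_periodic:
  fixes p h :: "int \<Rightarrow> 'v::real_inner"
  assumes "T > 0" "p \<in> periodic_seqs T" "h \<in> periodic_seqs T"
  shows "(\<Sum>t=1..T. p t \<bullet> fdiff h t) = (\<Sum>t=1..T. (p (t - 1) - p t) \<bullet> h t)"
proof -
  have "(\<Sum>t=1..T. p (t - 1) \<bullet> h t) = (\<Sum>t=1..T. p t \<bullet> h (t + 1))"
    using sum_periodic_pred[OF assms(1), of "\<lambda>t. p t \<bullet> h (t + 1)"] assms(2,3)
    by (simp add: periodic_seqs_def add.commute[of 1]) (metis add.commute add_0)
  then show ?thesis
    by (simp add: fdiff_def inner_diff_right inner_diff_left sum_subtractf)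
qed

section \<open>Topology of the periodic boxes\<close>

lemma closed_periodic_seqs: "closed (periodic_seqs T :: (int \<Rightarrow> 'v::t2_space) set)"
proof -
  have "periodic_seqs T = (\<Inter>t. {x :: int \<Rightarrow> 'v. x (t + T) = x t})"
    by (auto simp: periodic_seqs_def)
  moreover have "closed {x :: int \<Rightarrow> 'v. x (t + T) = x t}" for t
    by (intro closed_Collect_eq continuous_on_product_coordinates)
  ultimately show ?thesis by auto
qed

text \<open>Tychonoff: in the product topology the box is a closed subset of a product of compact
  balls.\<close>

lemma compact_periodic_box: "compact (periodic_box T R :: (int \<Rightarrow> 'v::euclidean_space) set)"
proof -
  have "periodic_box T R = PiE UNIV (\<lambda>_. cball 0 R) \<inter> (periodic_seqs T :: (int \<Rightarrow> 'v) set)"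
    by (auto simp: periodic_box_def PiE_def Pi_def)
  moreover have "compactin (product_topology (\<lambda>_::int. euclidean) UNIV) (PiE UNIV (\<lambda>_. cball (0::'v) R))"
    by (simp add: compactin_PiE)
  then have "compact (PiE (UNIV :: int set) (\<lambda>_. cball (0::'v) R))"
    by (simp add: euclidean_product_topology)
  ultimately show ?thesis
    using closed_periodic_seqs by (auto intro: compact_Int_closed)
qed

lemma periodic_box_mono: "R \<le> R' \<Longrightarrow> periodic_box T R \<subseteq> periodic_box T R'"
  unfolding periodic_box_def by (blast intro: order_trans)

text \<open>A box of nonnegative radius is star-shaped about the zero sequence: it is the union of
  the segments \<open>ray x\<close>, all of which contain zero.\<close>

lemma connected_periodic_box: "connected (periodic_box T R :: (int \<Rightarrow> 'v::real_normed_vector) set)"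
proof (cases "R \<ge> 0")
  case True
  define ray where "ray x = (\<lambda>\<sigma> t. \<sigma> *\<^sub>R x t) ` {0..1::real}" for x :: "int \<Rightarrow> 'v"
  have "connected (ray x)" for x
    unfolding ray_def
    by (intro connected_continuous_image continuous_on_coordinatewise_then_product continuous_intros) auto
  moreover have zero: "(\<lambda>_. 0) \<in> ray x" for x
    unfolding ray_def by (rule image_eqI[of _ _ 0]) auto
  moreover have "x \<in> ray x" for x
    unfolding ray_def by (rule image_eqI[of _ _ 1]) auto
  moreover have "ray x \<subseteq> periodic_box T R" if x: "x \<in> periodic_box T R" for x
  proof -
    have "\<sigma> * norm (x t) \<le> R" if "0 \<le> \<sigma>" "\<sigma> \<le> 1" for \<sigma> t
      using mult_left_le_one_le[OF norm_ge_zero[of "x t"] that] x unfolding periodic_box_def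
      by (metis (mono_tags, lifting) mem_Collect_eq order_trans)
    then show ?thesis
      using x by (auto simp: ray_def periodic_box_def periodic_seqs_def)
  qed
  ultimately have "periodic_box T R = \<Union> (ray ` periodic_box T R)" "connected (\<Union> (ray ` periodic_box T R))"
    by (blast, intro connected_Union) blast+
  then show ?thesis by metis
next
  case False
  then have "periodic_box T R = ({} :: (int \<Rightarrow> 'v) set)"
    by (auto simp: periodic_box_def dest: order_trans[OF norm_ge_zero])
  then show ?thesis by simp
qed

section \<open>First variation of the action and its decrease along Euler steps\<close>

lemma continuous_on_fdiff:
  fixes x :: "'x::topological_space \<Rightarrow> int \<Rightarrow> 'v::real_normed_vector"
  assumes "\<And>t. continuous_on S (\<lambda>z. x z t)"
  shows "continuous_on S (\<lambda>z. fdiff (x z) t)"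
  unfolding fdiff_def by (intro continuous_intros assms)

text \<open>The parameter \<open>z\<close> lets one form cover the identity, the projection of pairs
  of a step length and a sequence, and the Euler step itself.\<close>

lemma continuous_on_action_grad:
  fixes x :: "'x::topological_space \<Rightarrow> int \<Rightarrow> 'v::real_normed_vector"
  assumes "\<And>t. continuous_on UNIV (\<kappa> t)" "\<And>t. continuous_on UNIV (v t)"
    and "\<And>t. continuous_on S (\<lambda>z. x z t)"
  shows "continuous_on S (\<lambda>z. action_grad \<kappa> v (x z) t)"
  unfolding action_grad_def
  by (intro continuous_intros continuous_on_compose2[OF assms(1)] continuous_on_compose2[OF assms(2)]
      continuous_on_fdiff assms(3)) auto

lemma continuous_on_action:
  fixes T :: int
  assumes "\<And>t. t \<in> {1..T} \<Longrightarrow> continuous_on UNIV (K t)" "\<And>t. t \<in> {1..T} \<Longrightarrow> continuous_on UNIV (V t)"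
  shows "continuous_on UNIV (action T K V :: (int \<Rightarrow> 'v::real_normed_vector) \<Rightarrow> real)"
proof -
  have "continuous_on UNIV (\<lambda>x. \<Sum>t=1..T. K t (fdiff x t) + V t (x t :: 'v))"
    by (intro continuous_intros continuous_on_compose2[OF assms(1)] continuous_on_compose2[OF assms(2)]
      continuous_on_fdiff continuous_on_product_coordinates) auto
  then show ?thesis unfolding action_def[abs_def] .
qed

lemma GDERIV_chain_line:
  fixes x h :: "'v::real_inner"
  assumes "GDERIV f (x + s *\<^sub>R h) :> D"
  shows "((\<lambda>\<sigma>. f (x + \<sigma> *\<^sub>R h)) has_real_derivative D \<bullet> h) (at s)"
proof -
  have "(f has_derivative (\<lambda>k. k \<bullet> D)) (at (x + s *\<^sub>R h))"
    using assms by (simp add: gderiv_def)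
  moreover have "((\<lambda>\<sigma>. x + \<sigma> *\<^sub>R h) has_derivative (\<lambda>\<sigma>. \<sigma> *\<^sub>R h)) (at s)"
    by (auto intro!: derivative_eq_intros)
  ultimately have "((\<lambda>\<sigma>. f (x + \<sigma> *\<^sub>R h)) has_derivative (\<lambda>\<sigma>. (\<sigma> *\<^sub>R h) \<bullet> D)) (at s)"
    using has_derivative_compose[of "\<lambda>\<sigma>. x + \<sigma> *\<^sub>R h"] by blast
  then show ?thesis
    by (simp add: has_field_derivative_def inner_commute mult.commute[of "_ \<bullet> _"] mult_commute_abs)
qed

text \<open>Differentiation along \<open>h\<close> produces pairings with \<open>fdiff h\<close>;
  summation by parts over a period moves the difference onto \<open>\<kappa>\<close>.\<close>

lemma action_has_derivative_line:
  fixes x h :: "int \<Rightarrow> 'v::real_inner"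
  assumes T: "T > 0"
    and K: "\<And>t y. t \<in> {1..T} \<Longrightarrow> GDERIV (K t) y :> \<kappa> t y" and V: "\<And>t y. t \<in> {1..T} \<Longrightarrow> GDERIV (V t) y :> v t y"
    and per: "\<kappa> \<in> periodic_seqs T" and x: "x \<in> periodic_seqs T" and h: "h \<in> periodic_seqs T"
  shows "((\<lambda>\<sigma>. action T K V (\<lambda>t. x t + \<sigma> *\<^sub>R h t)) has_real_derivative
    (\<Sum>t=1..T. action_grad \<kappa> v (\<lambda>t. x t + s *\<^sub>R h t) t \<bullet> h t)) (at s)"
proof -
  let ?z = "\<lambda>t. x t + s *\<^sub>R h t"
  have z: "?z (t + T) = ?z t" for t using x h by (auto simp: periodic_seqs_def)
  have fd: "fdiff (\<lambda>t. x t + \<sigma> *\<^sub>R h t) t = fdiff x t + \<sigma> *\<^sub>R fdiff h t" for \<sigma> t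
    by (simp add: fdiff_def algebra_simps)
  have "((\<lambda>\<sigma>. action T K V (\<lambda>t. x t + \<sigma> *\<^sub>R h t)) has_real_derivative
    (\<Sum>t=1..T. \<kappa> t (fdiff ?z t) \<bullet> fdiff h t + v t (?z t) \<bullet> h t)) (at s)"
    unfolding action_def fd
    by (intro DERIV_sum DERIV_add GDERIV_chain_line K V)
  moreover have "(\<Sum>t=1..T. \<kappa> t (fdiff ?z t) \<bullet> fdiff h t) =
    (\<Sum>t=1..T. (\<kappa> (t - 1) (fdiff ?z (t - 1)) - \<kappa> t (fdiff ?z t)) \<bullet> h t)"
  proof (rule sum_by_parts_periodic[OF T _ h], unfold periodic_seqs_def mem_Collect_eq, intro allI)
    fix t
    have "fdiff ?z (t + T) = fdiff ?z t"
      unfolding fdiff_def using z[of t] z[of "t + 1"] by (simp add: add_ac)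
    then show "\<kappa> (t + T) (fdiff ?z (t + T)) = \<kappa> t (fdiff ?z t)"
      using per by (simp add: periodic_seqs_def)
  qed
  ultimately show ?thesis
    by (simp add: action_grad_def inner_add_left sum.distrib)
qed

lemma action_grad_periodic:
  assumes "\<kappa> \<in> periodic_seqs T" "v \<in> periodic_seqs T" "x \<in> periodic_seqs T"
  shows "action_grad \<kappa> v x \<in> periodic_seqs T"
proof -
  have x: "x (t + T) = x t" "x (t + T + 1) = x (t + 1)" "x (t + T - 1) = x (t - 1)" for t
    using assms(3) unfolding periodic_seqs_def mem_Collect_eq
    by (metis, metis add.assoc add.commute, metis add_diff_eq diff_add_eq)
  have "\<kappa> (t + T - 1) = \<kappa> (t - 1)" for t
    using assms(1) unfolding periodic_seqs_def mem_Collect_eq by (metis add_diff_eq diff_add_eq)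
  then show ?thesis
    using x assms(1,2) by (simp add: periodic_seqs_def action_grad_def fdiff_def)
qed

text \<open>Mean value theorem on the segment from \<open>x\<close> to its Euler step. At step
  length 0 the slope is minus the squared norm of \<open>g x\<close>; by compactness of
  \<open>D\<close> it exceeds this by less than \<open>\<epsilon>\<close> for all short steps,
  uniformly in \<open>x\<close>.\<close>

lemma action_descent:
  fixes D :: "(int \<Rightarrow> 'v::euclidean_space) set" and \<kappa> v :: "int \<Rightarrow> 'v \<Rightarrow> 'v"
  defines "g \<equiv> action_grad \<kappa> v"
  assumes T: "T > 0"
    and K: "\<And>t y. t \<in> {1..T} \<Longrightarrow> GDERIV (K t) y :> \<kappa> t y" "\<And>t. continuous_on UNIV (\<kappa> t)" "\<kappa> \<in> periodic_seqs T"
    and V: "\<And>t y. t \<in> {1..T} \<Longrightarrow> GDERIV (V t) y :> v t y" "\<And>t. continuous_on UNIV (v t)" "v \<in> periodic_seqs T"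
    and D: "compact D" "D \<subseteq> periodic_seqs T" and "\<epsilon> > 0"
  shows "\<exists>\<tau>>0. \<forall>\<sigma>\<in>{0..\<tau>}. \<forall>x\<in>D. action T K V (\<lambda>t. x t - \<sigma> *\<^sub>R g x t)
    \<le> action T K V x - \<sigma> * ((\<Sum>t=1..T. g x t \<bullet> g x t) - \<epsilon>)"
proof -
  \<comment> \<open>\<open>k s x > 0\<close> says that the slope at \<open>s\<close> is less than
    \<open>- (q - \<epsilon>)\<close>, where \<open>q\<close> is the squared norm of
    \<open>g x\<close>; and \<open>k 0 x = \<epsilon>\<close>.\<close>
  define k where "k \<sigma> x = (\<Sum>t=1..T. g (\<lambda>t. x t - \<sigma> *\<^sub>R g x t) t \<bullet> g x t) - (\<Sum>t=1..T. g x t \<bullet> g x t) + \<epsilon>"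
    for \<sigma> x
  have snd: "continuous_on UNIV (\<lambda>p :: real \<times> (int \<Rightarrow> 'v). snd p t)" for t
    by (rule continuous_on_product_then_coordinatewise) (intro continuous_intros)
  have g: "continuous_on UNIV (\<lambda>p :: real \<times> (int \<Rightarrow> 'v). g (snd p) t)" for t
    unfolding g_def by (intro continuous_on_action_grad K V snd)
  have "continuous_on UNIV (\<lambda>p :: real \<times> (int \<Rightarrow> 'v). g (\<lambda>t. snd p t - fst p *\<^sub>R g (snd p) t) t)" for t
    by (subst g_def, intro continuous_on_action_grad K V continuous_intros snd g)
  then have "continuous_on UNIV (\<lambda>p. k (fst p) (snd p))"
    unfolding k_def by (intro continuous_intros g)
  then obtain \<tau> where \<tau>: "\<tau> > 0" "\<forall>\<sigma>\<in>{0..\<tau>}. \<forall>x\<in>D. k \<sigma> x > 0"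
    using pos_near_zero_uniform[OF D(1), of k] \<open>\<epsilon> > 0\<close> by (auto simp: k_def)
  show ?thesis
  proof (intro exI[of _ \<tau>] conjI ballI \<tau>(1))
    fix \<sigma> x assume \<sigma>: "\<sigma> \<in> {0..\<tau>}" and x: "x \<in> D"
    let ?F = "\<lambda>\<sigma>. action T K V (\<lambda>t. x t + \<sigma> *\<^sub>R (- g x t))"
    let ?F' = "\<lambda>s. \<Sum>t=1..T. g (\<lambda>t. x t + s *\<^sub>R (- g x t)) t \<bullet> (- g x t)"
    have xT: "x \<in> periodic_seqs T" "(\<lambda>t. - g x t) \<in> periodic_seqs T"
      using x D(2) action_grad_periodic[OF K(3) V(3), of x]
      by (auto simp: g_def periodic_seqs_def)
    have der: "(?F has_real_derivative ?F' s) (at s)" for s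
      unfolding g_def by (intro action_has_derivative_line[OF T K(1) V(1) K(3)] xT[unfolded g_def])
    have bound: "?F' s \<le> - ((\<Sum>t=1..T. g x t \<bullet> g x t) - \<epsilon>)" if "s \<in> {0..\<tau>}" for s
      using \<tau>(2)[rule_format, OF that x] by (simp add: k_def sum_negf)
    show "action T K V (\<lambda>t. x t - \<sigma> *\<^sub>R g x t) \<le> action T K V x - \<sigma> * ((\<Sum>t=1..T. g x t \<bullet> g x t) - \<epsilon>)"
    proof (cases "\<sigma> = 0")
      case False
      then have "0 < \<sigma>" using \<sigma> by auto
      obtain s where s: "0 < s" "s < \<sigma>" "?F \<sigma> - ?F 0 = (\<sigma> - 0) * ?F' s"
        using MVT2[OF \<open>0 < \<sigma>\<close>, of ?F ?F'] der by blast
      have "\<sigma> * ?F' s \<le> \<sigma> * (- ((\<Sum>t=1..T. g x t \<bullet> g x t) - \<epsilon>))"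
        using s \<sigma> \<open>0 < \<sigma>\<close> by (intro mult_left_mono bound) auto
      moreover have "?F \<sigma> = action T K V (\<lambda>t. x t - \<sigma> *\<^sub>R g x t)" "?F 0 = action T K V x" by simp_all
      ultimately show ?thesis using s(3) by (simp add: algebra_simps)
    qed simp
  qed
qed

text \<open>The gap between \<open>R2\<close> and \<open>R3\<close> leaves room for an Euler step:
  values below \<open>L\<close> are confined to the box of radius \<open>R2\<close>, where the
  gradient is bounded. The box of radius \<open>R1\<close> is the connected set that joins the two
  minima.\<close>

theorem three_critical_points_action:
  fixes K V :: "int \<Rightarrow> 'v::euclidean_space \<Rightarrow> real" and \<Phi> :: "(int \<Rightarrow> 'v) \<Rightarrow> real"
  assumes T: "T > 0"
    and K: "\<And>t y. t \<in> {1..T} \<Longrightarrow> GDERIV (K t) y :> \<kappa> t y" "\<And>t. continuous_on UNIV (\<kappa> t)" "\<kappa> \<in> periodic_seqs T"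
    and V: "\<And>t y. t \<in> {1..T} \<Longrightarrow> GDERIV (V t) y :> v t y" "\<And>t. continuous_on UNIV (v t)" "v \<in> periodic_seqs T"
    and \<Phi>: "continuous_on UNIV \<Phi>"
    and R: "R1 \<le> R2" "R2 < R3"
    and inner: "\<And>x. x \<in> periodic_box T R1 \<Longrightarrow> action T K V x < L"
      "\<And>x. x \<in> periodic_box T R3 \<Longrightarrow> action T K V x < B \<Longrightarrow> x \<in> periodic_box T R1"
    and outer: "\<And>x. x \<in> periodic_box T R3 \<Longrightarrow> action T K V x < L \<Longrightarrow> x \<in> periodic_box T R2"
    and u0: "u0 \<in> periodic_box T R3" "\<Phi> u0 < r" "action T K V u0 < B"
    and u1: "u1 \<in> periodic_box T R3" "r < \<Phi> u1" "action T K V u1 < B"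
    and barrier: "\<And>x. x \<in> periodic_box T R3 \<Longrightarrow> \<Phi> x = r \<Longrightarrow> B \<le> action T K V x"
  shows "\<exists>S \<subseteq> {x \<in> periodic_box T R3. \<forall>t. action_grad \<kappa> v x t = 0}. card S = 3"
proof -
  define g where "g = action_grad \<kappa> v"
  define q where "q x = (\<Sum>t=1..T. g x t \<bullet> g x t)" for x
  define E where "E \<sigma> x = (\<lambda>t. x t - \<sigma> *\<^sub>R g x t)" for \<sigma> and x :: "int \<Rightarrow> 'v"
  note gper = action_grad_periodic[OF K(3) V(3), folded g_def]
  have box: "periodic_box T R \<subseteq> periodic_seqs T" for R by (auto simp: periodic_box_def)
  have q0: "g x t = 0" if "x \<in> periodic_seqs T" "q x = 0" for x t
  proof -
    have "\<forall>t\<in>{1..T}. g x t = 0"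
      using that(2) unfolding q_def by (subst (asm) sum_nonneg_eq_0_iff) auto
    then show ?thesis
      using periodic_all_iff[OF T gper[OF that(1)], of "\<lambda>y. y = 0"] by blast
  qed
  have gx: "continuous_on UNIV (\<lambda>x. g x t)" for t
    unfolding g_def by (intro continuous_on_action_grad K V continuous_on_product_coordinates)
  have snd: "continuous_on UNIV (\<lambda>p :: real \<times> (int \<Rightarrow> 'v). snd p t)" for t
    by (rule continuous_on_product_then_coordinatewise) (intro continuous_intros)
  have g: "continuous_on UNIV (\<lambda>p :: real \<times> (int \<Rightarrow> 'v). g (snd p) t)" for t
    unfolding g_def by (intro continuous_on_action_grad K V snd)
  have E: "continuous_on UNIV (\<lambda>p. E (fst p) (snd p))"
    unfolding E_def by (intro continuous_on_coordinatewise_then_product continuous_intros snd g)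
  have KV: "continuous_on UNIV (K t)" "continuous_on UNIV (V t)" if "t \<in> {1..T}" for t
    using K(1)[OF that] V(1)[OF that] unfolding gderiv_def
    by (meson continuous_at_imp_continuous_on has_derivative_continuous)+
  have q: "continuous_on UNIV q"
    unfolding q_def by (intro continuous_intros gx)
  have stay: "\<exists>\<tau>>0. \<forall>\<sigma>\<in>{0..\<tau>}. \<forall>x\<in>periodic_box T R3. action T K V x < L \<longrightarrow> E \<sigma> x \<in> periodic_box T R3"
  proof -
    have "bounded (q ` periodic_box T R2)"
      by (intro compact_imp_bounded compact_continuous_image compact_periodic_box continuous_on_subset[OF q]) auto
    then obtain M where M: "M > 0" "\<And>x. x \<in> periodic_box T R2 \<Longrightarrow> \<bar>q x\<bar> \<le> M"
      unfolding bounded_pos by auto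
    have g_le: "norm (g x t) \<le> 1 + M" if x: "x \<in> periodic_box T R2" for x t
    proof -
      have "norm (g x t) \<le> 1 + M" if t: "t \<in> {1..T}" for t
      proof -
        have "g x t \<bullet> g x t \<le> q x"
          unfolding q_def using t by (intro member_le_sum) auto
        then have "(norm (g x t))\<^sup>2 \<le> M" using M(2)[OF x] by (simp add: power2_norm_eq_inner)
        \<comment> \<open>From \<open>(n - 1/2)\<^sup>2 \<ge> 0\<close>; the bound
          \<open>1 + M\<close> thereby avoids a square root.\<close>
        moreover have "norm (g x t) \<le> 1 + (norm (g x t))\<^sup>2"
          using sum_power2_ge_zero[of "norm (g x t) - 1/2" 0] by (simp add: power2_eq_square algebra_simps)
        ultimately show ?thesis by linarith
      qed
      then show ?thesis
        using periodic_all_iff[OF T gper, of x "\<lambda>y. norm y \<le> 1 + M"] x box by blast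
    qed
    show ?thesis
    \<comment> \<open>With the gradient bounded by \<open>1 + M\<close>, a step of this length moves
      each term by at most \<open>R3 - R2\<close>.\<close>
    proof (intro exI[of _ "(R3 - R2) / (1 + M)"] conjI ballI impI)
      show "(R3 - R2) / (1 + M) > 0" using M R by simp
      fix \<sigma> x assume \<sigma>: "\<sigma> \<in> {0..(R3 - R2) / (1 + M)}" and x: "x \<in> periodic_box T R3" "action T K V x < L"
      have x2: "x \<in> periodic_box T R2" using outer x by blast
      have "norm (E \<sigma> x t) \<le> R3" for t
      proof -
        have "norm (E \<sigma> x t) \<le> norm (x t) + \<sigma> * norm (g x t)"
          unfolding E_def using norm_triangle_ineq4[of "x t" "\<sigma> *\<^sub>R g x t"] \<sigma> by simp
        also have "\<dots> \<le> R2 + (R3 - R2) / (1 + M) * (1 + M)"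
          using x2 g_le[OF x2] \<sigma> M R by (intro add_mono mult_mono) (auto simp: periodic_box_def)
        finally show ?thesis using M by simp
      qed
      moreover have "E \<sigma> x \<in> periodic_seqs T"
        using x(1) box gper[of x] by (auto simp: E_def periodic_seqs_def periodic_box_def)
      ultimately show "E \<sigma> x \<in> periodic_box T R3" by (simp add: periodic_box_def)
    qed
  qed
  have "\<exists>S \<subseteq> {x \<in> periodic_box T R3. q x = 0}. card S = 3"
  proof (rule three_critical_points_compact[where f = "action T K V" and E = E and \<Phi> = \<Phi> and r = r
        and A = "periodic_box T R1" and L = L and B = B and ?u0.0 = u0 and ?u1.0 = u1])
    show "\<exists>\<tau>>0. \<forall>\<sigma>\<in>{0..\<tau>}. \<forall>x\<in>periodic_box T R3. action T K V (E \<sigma> x) \<le> action T K V x - \<sigma> * (q x - \<epsilon>)"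
      if "\<epsilon> > 0" for \<epsilon>
      unfolding E_def q_def g_def
      by (rule action_descent[OF T K V compact_periodic_box box that])
    show "E \<sigma> x = x" if "x \<in> periodic_box T R3" "q x = 0" for \<sigma> x
    proof -
      have "g x t = 0" for t using q0[of x t] that box[of R3] by blast
      then show ?thesis by (simp add: E_def)
    qed
    show "periodic_box T R1 \<subseteq> periodic_box T R3" using R by (intro periodic_box_mono) simp
    show "0 \<le> q x" for x unfolding q_def by (intro sum_nonneg) auto
    show "continuous_on UNIV (action T K V)" by (intro continuous_on_action KV)
  qed (use compact_periodic_box connected_periodic_box q \<Phi> E stay inner u0 u1 barrier in \<open>auto simp: E_def\<close>)
  then obtain S where S: "S \<subseteq> {x \<in> periodic_box T R3. q x = 0}" "card S = 3" by blast
  have "S \<subseteq> {x \<in> periodic_box T R3. \<forall>t. action_grad \<kappa> v x t = 0}"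
    using S(1) q0 box unfolding g_def by blast
  then show ?thesis using S(2) by blast
qed

section \<open>Gradients, barriers and coercivity\<close>

lemma continuous_bounded_on_compact:
  fixes f :: "'x::topological_space \<Rightarrow> real"
  assumes "compact D" "continuous_on UNIV f"
  obtains M where "\<And>x. x \<in> D \<Longrightarrow> \<bar>f x\<bar> \<le> M" "M > 0"
proof -
  have "bounded (f ` D)"
    by (intro compact_imp_bounded compact_continuous_image continuous_on_subset[OF assms(2)] assms) auto
  then show thesis unfolding bounded_pos using that by auto
qed

lemma eventually_norm_sum_infinity:
  "eventually Q norm_sum_infinity \<longleftrightarrow> (\<exists>R. \<forall>x y. norm x + norm y \<ge> R \<longrightarrow> Q (x, y))"
  unfolding norm_sum_infinity_def eventually_filtercomap eventually_at_top_linorder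
  by (auto; metis case_prod_conv)

section \<open>Uniqueness of gradients, and gradients on products\<close>

lemma GDERIV_unique:
  assumes "GDERIV f x :> D" "GDERIV f x :> D'"
  shows "D = D'"
proof -
  have "(\<lambda>h. inner h D) = (\<lambda>h. inner h D')"
    using assms unfolding gderiv_def by (rule has_derivative_unique)
  then show ?thesis by (metis inner_commute vector_eq_rdot)
qed

lemma grad_eqI: "GDERIV f x :> D \<Longrightarrow> grad f x = D"
  unfolding grad_def using GDERIV_unique by (intro the_equality)

lemma C1_fun_grad:
  assumes "C1_fun f"
  shows "GDERIV f x :> grad f x" "continuous_on UNIV (grad f)"
proof -
  obtain g where g: "\<And>x. GDERIV f x :> g x" "continuous_on UNIV g"
    using assms unfolding C1_fun_def by blast
  then have "grad f = g" using grad_eqI by blast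
  then show "GDERIV f x :> grad f x" "continuous_on UNIV (grad f)" using g by simp_all
qed

lemma GDERIV_isCont: "GDERIV f x :> D \<Longrightarrow> isCont f x"
  unfolding gderiv_def by (rule has_derivative_continuous)

lemma GDERIV_cmult: "GDERIV f x :> D \<Longrightarrow> GDERIV (\<lambda>x. c * f x) x :> c *\<^sub>R D"
  using GDERIV_mult[OF GDERIV_const] by fastforce

lemma GDERIV_fst: "GDERIV f (fst p) :> D \<Longrightarrow> GDERIV (\<lambda>p. f (fst p)) p :> (D, 0)"
  unfolding gderiv_def inner_prod_def
  using has_derivative_compose[OF has_derivative_fst[OF has_derivative_ident], of f "\<lambda>h. h \<bullet> D" p UNIV]
  by simp

lemma GDERIV_snd: "GDERIV f (snd p) :> D \<Longrightarrow> GDERIV (\<lambda>p. f (snd p)) p :> (0, D)"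
  unfolding gderiv_def inner_prod_def
  using has_derivative_compose[OF has_derivative_snd[OF has_derivative_ident], of f "\<lambda>h. h \<bullet> D" p UNIV]
  by simp

text \<open>The system differentiates \<open>W\<close> in one variable with the other frozen,
  whereas the potential of the action is differentiated jointly; this lemma and the next connect the
  two.\<close>

lemma GDERIV_section1:
  assumes "GDERIV f (x, y) :> D"
  shows "GDERIV (\<lambda>x. f (x, y)) x :> fst D"
proof -
  have "((\<lambda>x. (x, y)) has_derivative (\<lambda>h. (h, 0))) (at x)"
    by (intro derivative_intros)
  from has_derivative_compose[OF this, of f "\<lambda>h. h \<bullet> D"] assms show ?thesis
    by (simp add: gderiv_def inner_prod_def)
qed

lemma GDERIV_section2:
  assumes "GDERIV f (x, y) :> D"
  shows "GDERIV (\<lambda>y. f (x, y)) y :> snd D"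
proof -
  have "((\<lambda>y. (x, y)) has_derivative (\<lambda>h. (0, h))) (at y)"
    by (intro derivative_intros)
  from has_derivative_compose[OF this, of f "\<lambda>h. h \<bullet> D"] assms show ?thesis
    by (simp add: gderiv_def inner_prod_def)
qed

text \<open>Write \<open>\<eta>\<close> and \<open>\<gamma>\<close> for the infima
  \<open>eta\<close> and \<open>gamma_inf\<close>. If both are finite, clearing the denominator in a
  quotient below \<open>\<mu>\<close> gives
  \<open>\<mu> * I u + \<Psi> u < \<mu> * \<eta> + \<gamma> - r\<close>. The right side is the
  barrier \<open>b\<close>, since \<open>I \<ge> \<eta>\<close> and
  \<open>\<Psi> + r \<ge> \<gamma>\<close> on \<open>{\<Phi> = r}\<close>.\<close>

lemma mu_star_barrier:
  fixes I \<Psi> \<Phi> :: "'a \<Rightarrow> real"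
  assumes "\<mu> > 0" "mu_star E I \<Psi> \<Phi> r < ereal \<mu>"
  obtains u b where "u \<in> E" "\<Phi> u < r" "\<mu> * I u + \<Psi> u < b"
    "\<And>v. v \<in> E \<Longrightarrow> \<Phi> v = r \<Longrightarrow> b \<le> \<mu> * I v + \<Psi> v"
proof -
  obtain u where u: "u \<in> E" "\<Phi> u < r" "ereal (I u) < eta E I \<Phi> r"
    and lt: "(ereal (\<Psi> u) - gamma_inf E \<Psi> \<Phi> + ereal r) / (eta E I \<Phi> r - ereal (I u)) < ereal \<mu>"
    using assms(2) unfolding mu_star_def INF_less_iff by auto
  have eta: "eta E I \<Phi> r \<le> ereal (I v)" if "v \<in> E" "\<Phi> v = r" for v
    unfolding eta_def using that by (intro INF_lower) auto
  have gamma: "gamma_inf E \<Psi> \<Phi> \<le> ereal (\<Psi> v + \<Phi> v)" if "v \<in> E" for v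
    unfolding gamma_inf_def using that by (intro INF_lower)
  show thesis
  proof (cases "eta E I \<Phi> r")
    case (real e)
    then have "I u < e" using u by simp
    show thesis
    proof (cases "gamma_inf E \<Psi> \<Phi>")
      case (real g)
      with lt \<open>eta E I \<Phi> r = ereal e\<close> \<open>I u < e\<close> have "(\<Psi> u - g + r) / (e - I u) < \<mu>"
        by simp
      then have "\<Psi> u - g + r < \<mu> * (e - I u)"
        using \<open>I u < e\<close> by (simp add: pos_divide_less_eq)
      moreover have "\<mu> * e + g - r \<le> \<mu> * I v + \<Psi> v" if v: "v \<in> E" "\<Phi> v = r" for v
      proof -
        have "e \<le> I v" "g \<le> \<Psi> v + r"
          using eta[OF v] gamma[OF v(1)] v(2) real \<open>eta E I \<Phi> r = ereal e\<close> by auto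
        moreover have "\<mu> * e \<le> \<mu> * I v" using \<open>e \<le> I v\<close> assms(1) by simp
        ultimately show ?thesis by linarith
      qed
      ultimately show thesis
        using that[of u "\<mu> * e + g - r"] u by (simp add: algebra_simps)
    next
      case PInf
      then show thesis using gamma[OF u(1)] by simp
    next
      \<comment> \<open>The quotient would be infinite, against \<open>lt\<close>.\<close>
      case MInf
      then show thesis using lt \<open>eta E I \<Phi> r = ereal e\<close> \<open>I u < e\<close> by simp
    qed
  next
    \<comment> \<open>An infinite \<open>eta\<close> means that no point of \<open>E\<close> has
      \<open>\<Phi> = r\<close>, so any \<open>b\<close> above the value at \<open>u\<close> will
      do.\<close>
    case PInf
    then have "v \<notin> E" if "\<Phi> v = r" for v using eta[OF _ that] by auto
    then show thesis using that[of u "\<mu> * I u + \<Psi> u + 1"] u by auto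
  next
    case MInf
    then show thesis using u(3) by simp
  qed
qed

text \<open>The denominator \<open>r - \<Phi> u\<close> is negative, so a quotient above
  \<open>b\<close> becomes \<open>J u + b * (\<Phi> u - r) < m\<close> with \<open>m\<close> the
  infimum of \<open>J\<close> over \<open>{\<Phi> \<le> r}\<close>; and \<open>u0\<close> competes
  in that infimum.\<close>

lemma beta_witness:
  fixes J \<Phi> :: "'a \<Rightarrow> real"
  assumes "ereal b < beta E J \<Phi> r" and u0: "u0 \<in> E" "\<Phi> u0 < r"
  obtains u where "u \<in> E" "r < \<Phi> u" "J u + b * (\<Phi> u - r) \<le> J u0"
proof -
  define m where "m = (INF v\<in>{v\<in>E. \<Phi> v \<le> r}. ereal (J v))"
  obtain u where u: "u \<in> E" "r < \<Phi> u" and lt: "ereal b < (ereal (J u) - m) / ereal (r - \<Phi> u)"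
    using assms(1) unfolding beta_def less_SUP_iff m_def by auto
  have m: "m \<le> ereal (J u0)"
    unfolding m_def using u0 by (intro INF_lower) auto
  show thesis
  proof (cases m)
    case (real k)
    then have "b < (J u - k) / (r - \<Phi> u)" using lt u by simp
    then have "J u - k < b * (r - \<Phi> u)" using u by (simp add: neg_less_divide_eq)
    moreover have "k \<le> J u0" using m real by simp
    ultimately show thesis using that[OF u] by (simp add: algebra_simps)
  next
    case PInf
    then show thesis using m by simp
  next
    \<comment> \<open>An infinite numerator over a negative denominator gives minus infinity, which
      is not above \<open>b\<close>.\<close>
    case MInf
    then show thesis using lt u by (simp add: ereal_divide_eq_0_iff divide_ereal_def)
  qed
qed

text \<open>With \<open>w = norm x powr s + norm y powr s\<close>, far out \<open>f < k * w\<close>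
  and \<open>a * g \<ge> (k + 1) * w\<close>, so the difference exceeds \<open>w\<close>, which
  tends to infinity.\<close>

lemma coercive_difference:
  fixes f g :: "'v::real_normed_vector \<times> 'v \<Rightarrow> real"
  assumes "a > 0" "s > 0"
    and f: "((\<lambda>(x, y). ereal (f (x, y) / (norm x powr s + norm y powr s))) \<longlongrightarrow> L) norm_sum_infinity" "L < \<infinity>"
    and g: "filterlim (\<lambda>(x, y). g (x, y) / (norm x powr s + norm y powr s)) at_top norm_sum_infinity"
  shows "\<exists>R. \<forall>p. norm p \<ge> R \<longrightarrow> C \<le> a * g p - f p"
proof -
  obtain k where k: "L < ereal k" using f(2) less_PInf_Ex_of_nat by (metis ereal_dense2)
  \<comment> \<open>Beyond norm \<open>2 * Z\<close> one of the two components has norm at least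
    \<open>Z\<close>, and \<open>Z powr s = \<bar>C\<bar> + 1\<close> then gives
    \<open>w \<ge> \<bar>C\<bar> + 1\<close>.\<close>
  define Z where "Z = (\<bar>C\<bar> + 1) powr (1 / s)"
  have "eventually (\<lambda>p. case p of (x, y) \<Rightarrow> ereal (f (x, y) / (norm x powr s + norm y powr s)) < ereal k) norm_sum_infinity"
    using order_tendstoD(2)[OF f(1) k] by (simp add: case_prod_unfold)
  moreover have "eventually (\<lambda>p. case p of (x, y) \<Rightarrow> (k + 1) / a \<le> g (x, y) / (norm x powr s + norm y powr s)) norm_sum_infinity"
    using g unfolding filterlim_at_top by (simp add: case_prod_unfold)
  ultimately obtain R1 R2 where
    R1: "\<And>x y. norm x + norm y \<ge> R1 \<Longrightarrow> f (x, y) / (norm x powr s + norm y powr s) < k" and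
    R2: "\<And>x y. norm x + norm y \<ge> R2 \<Longrightarrow> (k + 1) / a \<le> g (x, y) / (norm x powr s + norm y powr s)"
    unfolding eventually_norm_sum_infinity by auto
  show ?thesis
  proof (intro exI allI impI)
    fix p :: "'v \<times> 'v" assume p: "max (max R1 R2) (2 * Z) \<le> norm p"
    obtain x y where xy: "p = (x, y)" by force
    define w where "w = norm x powr s + norm y powr s"
    have n: "norm p \<le> norm x + norm y"
      unfolding xy norm_Pair by (intro sqrt_sum_squares_le_sum) auto
    have "Z \<le> norm x \<or> Z \<le> norm y" using n p by linarith
    moreover have "Z \<ge> 0" unfolding Z_def by simp
    moreover have "Z powr s = \<bar>C\<bar> + 1" unfolding Z_def using assms(2) by (simp add: powr_powr)
    ultimately have "\<bar>C\<bar> + 1 \<le> norm x powr s \<or> \<bar>C\<bar> + 1 \<le> norm y powr s"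
      using powr_mono2[of s Z "norm x"] powr_mono2[of s Z "norm y"] assms(2) by auto
    then have w: "\<bar>C\<bar> + 1 \<le> w"
      unfolding w_def by (meson add_increasing add_increasing2 powr_ge_zero)
    have "f p < k * w"
      using R1[of x y] n p w unfolding xy w_def by (simp add: pos_divide_less_eq)
    moreover have "(k + 1) * w \<le> a * g p"
      using R2[of x y] n p w \<open>a > 0\<close> unfolding xy w_def[symmetric]
      by (simp add: pos_le_divide_eq pos_divide_le_eq field_simps)
    ultimately show "C \<le> a * g p - f p"
      using w by (simp add: algebra_simps)
  qed
qed

text \<open>Every \<open>k t\<close> is bounded below, so a very large term cannot be offset by the
  others.\<close>

lemma coercive_sum:
  fixes k :: "int \<Rightarrow> 'v::euclidean_space \<Rightarrow> real" and T :: int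
  assumes cont: "\<And>t. t \<in> {1..T} \<Longrightarrow> continuous_on UNIV (k t)"
    and coer: "\<And>t C. t \<in> {1..T} \<Longrightarrow> \<exists>R. \<forall>p. norm p \<ge> R \<longrightarrow> C \<le> k t p"
  shows "\<exists>R. \<forall>x. (\<Sum>t=1..T. k t (x t)) \<le> C \<longrightarrow> (\<forall>t\<in>{1..T}. norm (x t) \<le> R)"
proof -
  have "\<exists>m. \<forall>p. m \<le> k t p" if t: "t \<in> {1..T}" for t
  proof -
    obtain R where R: "\<And>p. norm p \<ge> R \<Longrightarrow> 0 \<le> k t p" using coer[OF t] by blast
    obtain M where "\<And>p. p \<in> cball 0 R \<Longrightarrow> \<bar>k t p\<bar> \<le> M" "M > 0"
      using continuous_bounded_on_compact[OF compact_cball cont[OF t]] by blast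
    then have M: "M > 0" "\<And>p. norm p \<le> R \<Longrightarrow> - M \<le> k t p"
      by (simp_all add: abs_le_iff) (metis minus_le_iff)
    have "- M \<le> k t p" for p
      using R[of p] M(1) M(2)[of p] by linarith
    then show ?thesis by blast
  qed
  then obtain m where m: "\<And>t p. t \<in> {1..T} \<Longrightarrow> m t \<le> k t p" by metis
  \<comment> \<open>One term of this size, with each other term at least its lower bound, brings the
    sum to \<open>C + 1\<close> or more.\<close>
  have "\<forall>t\<in>{1..T}. \<exists>R. \<forall>p. norm p \<ge> R \<longrightarrow> C - (\<Sum>t=1..T. m t) + m t + 1 \<le> k t p"
    using coer by blast
  then obtain R where R: "\<And>t p. t \<in> {1..T} \<Longrightarrow> norm p \<ge> R t \<Longrightarrow> C - (\<Sum>t=1..T. m t) + m t + 1 \<le> k t p"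
    by metis
  show ?thesis
  proof (intro exI allI impI ballI)
    fix x t assume le: "(\<Sum>t=1..T. k t (x t)) \<le> C" and t: "t \<in> {1..T}"
    have "norm (x t) \<le> \<bar>R t\<bar>"
    proof (rule ccontr)
      assume "\<not> ?thesis"
      then have "C - (\<Sum>t=1..T. m t) + m t + 1 \<le> k t (x t)" using R[OF t, of "x t"] by linarith
      moreover have "sum m ({1..T} - {t}) \<le> (\<Sum>t\<in>{1..T} - {t}. k t (x t))"
        using m by (intro sum_mono) auto
      moreover have "(\<Sum>t=1..T. m t) = m t + sum m ({1..T} - {t})"
        "(\<Sum>t=1..T. k t (x t)) = k t (x t) + (\<Sum>t\<in>{1..T} - {t}. k t (x t))"
        using t by (auto intro: sum.remove)
      ultimately show False using le by linarith
    qed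
    also have "\<dots> \<le> (\<Sum>t=1..T. \<bar>R t\<bar>)"
      using t by (intro member_le_sum) auto
    finally show "norm (x t) \<le> (\<Sum>t=1..T. \<bar>R t\<bar>)" .
  qed
qed

lemma norm_E_bounded:
  fixes T :: int
  assumes "\<theta> > 0"
  shows "\<exists>R'>0. \<forall>u :: ('n::finite) seq \<times> 'n seq.
    (\<forall>t. norm (fst u t) \<le> R \<and> norm (snd u t) \<le> R) \<longrightarrow> norm_E T \<theta> u < R'"
proof -
  define b where "b = ((\<Sum>t=1..T. (2 * R) powr \<theta>) + (\<Sum>t=1..T. R powr \<theta>)) powr (1 / \<theta>)"
  have le: "norm_ET T \<theta> h \<le> b" if h: "\<And>t. norm (h t) \<le> R" for h :: "'n seq"
  proof -
    have "norm (fdiff h t) \<le> 2 * R" for t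
      unfolding fdiff_def using norm_triangle_ineq4[of "h (t + 1)" "h t"] h[of t] h[of "t + 1"] by linarith
    then show ?thesis
      unfolding norm_ET_def b_def using assms h
      by (intro powr_mono2 add_mono sum_mono add_nonneg_nonneg sum_nonneg) auto
  qed
  show ?thesis
  proof (intro exI[of _ "2 * b + 1"] conjI allI impI)
    show "2 * b + 1 > 0" unfolding b_def by (simp add: add_nonneg_pos)
    fix u :: "'n seq \<times> 'n seq"
    assume "\<forall>t. norm (fst u t) \<le> R \<and> norm (snd u t) \<le> R"
    then show "norm_E T \<theta> u < 2 * b + 1"
      unfolding norm_E_def using le[of "fst u"] le[of "snd u"] by auto
  qed
qed

text \<open>On \<open>{\<Phi> = r}\<close> the functional \<open>J + \<alpha> \<Phi>\<close> is at
  least \<open>B + \<alpha> * r\<close>, while at \<open>u0\<close> and \<open>u1\<close> it is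
  lower by at least \<open>e = B - J u0\<close>; for \<open>u1\<close> the inequality at
  \<open>b\<close> passes to every \<open>\<alpha> \<le> b\<close> because
  \<open>\<Phi> u1 > r\<close>. A perturbation of size at most \<open>e / 3\<close> preserves this
  separation. All radii and \<open>\<delta>\<close> are fixed before
  \<open>\<alpha>\<close>.\<close>

lemma three_critical_points_uniform:
  fixes K :: "int \<Rightarrow> 'v::euclidean_space \<Rightarrow> real" and V :: "real \<Rightarrow> real \<Rightarrow> int \<Rightarrow> 'v \<Rightarrow> real"
    and J \<Phi> h :: "(int \<Rightarrow> 'v) \<Rightarrow> real"
  assumes T: "T > 0"
    and K: "\<And>t y. t \<in> {1..T} \<Longrightarrow> GDERIV (K t) y :> \<kappa> t y" "\<And>t. continuous_on UNIV (\<kappa> t)" "\<kappa> \<in> periodic_seqs T"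
    and V: "\<And>\<alpha> \<nu> t y. t \<in> {1..T} \<Longrightarrow> GDERIV (V \<alpha> \<nu> t) y :> v \<alpha> \<nu> t y" "\<And>\<alpha> \<nu> t. continuous_on UNIV (v \<alpha> \<nu> t)"
      "\<And>\<alpha> \<nu>. v \<alpha> \<nu> \<in> periodic_seqs T"
    and action: "\<And>\<alpha> \<nu> x. action T K (V \<alpha> \<nu>) x = J x + \<alpha> * \<Phi> x - \<nu> * h x"
    and J: "continuous_on UNIV J" and \<Phi>: "continuous_on UNIV \<Phi>" and h: "continuous_on UNIV h"
    and coercive: "\<And>\<alpha> C. \<alpha> > 0 \<Longrightarrow> \<exists>R. \<forall>x\<in>periodic_seqs T. J x + \<alpha> * \<Phi> x \<le> C \<longrightarrow> x \<in> periodic_box T R"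
    and ab: "0 < a" "a \<le> b" and r: "r > 0"
    and u0: "u0 \<in> periodic_seqs T" "\<Phi> u0 < r" "J u0 < B"
    and u1: "u1 \<in> periodic_seqs T" "r < \<Phi> u1" "J u1 + b * (\<Phi> u1 - r) \<le> J u0"
    and barrier: "\<And>x. x \<in> periodic_seqs T \<Longrightarrow> \<Phi> x = r \<Longrightarrow> B \<le> J x"
  shows "\<exists>R \<delta>. \<delta> > 0 \<and> (\<forall>\<alpha>\<in>{a..b}. \<forall>\<nu>\<in>{0..\<delta>}.
    \<exists>S \<subseteq> {x \<in> periodic_box T R. \<forall>t. action_grad \<kappa> (v \<alpha> \<nu>) x t = 0}. card S = 3)"
proof -
  define f where "f \<alpha> x = J x + \<alpha> * \<Phi> x" for \<alpha> x
  have box: "periodic_box T R \<subseteq> periodic_seqs T" for R by (auto simp: periodic_box_def)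
  \<comment> \<open>\<open>f \<alpha> x\<close> is affine in \<open>\<alpha>\<close>, so bounds at the end points of \<open>{a..b}\<close> are uniform in \<open>\<alpha>\<close>.\<close>
  have f_between: "min (f a x) (f b x) \<le> f \<alpha> x \<and> f \<alpha> x \<le> max (f a x) (f b x)" if "\<alpha> \<in> {a..b}" for \<alpha> x
  proof (cases "\<Phi> x \<ge> 0")
    case True
    then show ?thesis
      using mult_right_mono[of a \<alpha> "\<Phi> x"] mult_right_mono[of \<alpha> b "\<Phi> x"] that unfolding f_def by auto
  next
    case False
    then show ?thesis
      using mult_right_mono_neg[of a \<alpha> "\<Phi> x"] mult_right_mono_neg[of \<alpha> b "\<Phi> x"] that unfolding f_def by auto
  qed
  have coer: "\<exists>R. \<forall>\<alpha>\<in>{a..b}. \<forall>x\<in>periodic_seqs T. f \<alpha> x \<le> C \<longrightarrow> x \<in> periodic_box T R" for C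
  proof -
    obtain Ra Rb where R: "\<And>x. x \<in> periodic_seqs T \<Longrightarrow> f a x \<le> C \<Longrightarrow> x \<in> periodic_box T Ra"
      "\<And>x. x \<in> periodic_seqs T \<Longrightarrow> f b x \<le> C \<Longrightarrow> x \<in> periodic_box T Rb"
      using coercive[of a C] coercive[of b C] ab unfolding f_def by fastforce
    have "x \<in> periodic_box T (max Ra Rb)" if "\<alpha> \<in> {a..b}" "x \<in> periodic_seqs T" "f \<alpha> x \<le> C" for \<alpha> x
    proof -
      have "f a x \<le> C \<or> f b x \<le> C" using f_between[OF that(1), of x] that(3) by linarith
      then show ?thesis
        using R that(2) periodic_box_mono[of Ra "max Ra Rb" T] periodic_box_mono[of Rb "max Ra Rb" T] by auto
    qed
    then show ?thesis by blast
  qed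
  have fcont: "continuous_on UNIV (f \<alpha>)" for \<alpha>
    unfolding f_def by (intro continuous_intros J \<Phi>)
  \<comment> \<open>The minima are sought at levels below \<open>B + b * r\<close>; the extra 1
    absorbs the perturbation.\<close>
  obtain R1 where R1: "\<And>\<alpha> x. \<alpha> \<in> {a..b} \<Longrightarrow> x \<in> periodic_seqs T \<Longrightarrow> f \<alpha> x \<le> B + b * r + 1 \<Longrightarrow> x \<in> periodic_box T R1"
    using coer by blast
  obtain Ca where Ca: "\<And>x. x \<in> periodic_box T R1 \<Longrightarrow> \<bar>f a x\<bar> \<le> Ca"
    using continuous_bounded_on_compact[OF compact_periodic_box fcont] by blast
  obtain Cb where Cb: "\<And>x. x \<in> periodic_box T R1 \<Longrightarrow> \<bar>f b x\<bar> \<le> Cb"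
    using continuous_bounded_on_compact[OF compact_periodic_box fcont] by blast
  define C where "C = max Ca Cb"
  have C: "f \<alpha> x \<le> C" if "\<alpha> \<in> {a..b}" "x \<in> periodic_box T R1" for \<alpha> x
    using f_between[OF that(1), of x] Ca[OF that(2)] Cb[OF that(2)] unfolding C_def by linarith
  \<comment> \<open>\<open>L\<close> will be \<open>C + 2\<close>: the perturbed functional is at
    most \<open>C + 1\<close> on the box of radius \<open>R1\<close>, and where it is below
    \<open>L\<close> the unperturbed one is at most \<open>C + 3\<close>.\<close>
  obtain R2' where R2': "\<And>\<alpha> x. \<alpha> \<in> {a..b} \<Longrightarrow> x \<in> periodic_seqs T \<Longrightarrow> f \<alpha> x \<le> C + 3 \<Longrightarrow> x \<in> periodic_box T R2'"
    using coer by blast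
  define R2 where "R2 = max R1 R2'"
  have R2: "x \<in> periodic_box T R2" if "\<alpha> \<in> {a..b}" "x \<in> periodic_seqs T" "f \<alpha> x \<le> C + 3" for \<alpha> x
    using R2'[OF that] periodic_box_mono[of R2' R2 T] unfolding R2_def by auto
  define R3 where "R3 = R2 + 1"
  have R: "R1 \<le> R2" "R2 < R3" "R1 \<le> R3" unfolding R2_def R3_def by auto
  have box13: "periodic_box T R1 \<subseteq> periodic_box T R3" using R by (intro periodic_box_mono)
  obtain M where M: "\<And>x. x \<in> periodic_box T R3 \<Longrightarrow> \<bar>h x\<bar> \<le> M" "M > 0"
    using continuous_bounded_on_compact[OF compact_periodic_box h] by blast
  define e where "e = B - J u0"
  have "e > 0" using u0 by (simp add: e_def)
  \<comment> \<open>On the largest box the perturbation is then at most 1, as the radii allow, and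
    at most \<open>e / 3\<close>, as the barrier allows.\<close>
  define \<delta> where "\<delta> = min 1 (e / 3) / M"
  have pert: "\<bar>\<nu> * h x\<bar> \<le> min 1 (e / 3)" if "\<nu> \<in> {0..\<delta>}" "x \<in> periodic_box T R3" for \<nu> x
  proof -
    have "\<nu> * \<bar>h x\<bar> \<le> \<delta> * M" using that M(1)[OF that(2)] by (intro mult_mono) auto
    then show ?thesis using that(1) M(2) by (simp add: \<delta>_def abs_mult)
  qed
  have low: "f \<alpha> u0 \<le> B - e + \<alpha> * r" "f \<alpha> u1 \<le> B - e + \<alpha> * r" "B - e + \<alpha> * r \<le> B + b * r" if "\<alpha> \<in> {a..b}" for \<alpha>
  proof -
    have "\<alpha> * \<Phi> u0 \<le> \<alpha> * r" using that ab u0 by (intro mult_left_mono) auto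
    then show "f \<alpha> u0 \<le> B - e + \<alpha> * r" by (simp add: f_def e_def)
    have "\<alpha> * (\<Phi> u1 - r) \<le> b * (\<Phi> u1 - r)" using that u1 by (intro mult_right_mono) auto
    then show "f \<alpha> u1 \<le> B - e + \<alpha> * r" using u1(3) unfolding f_def e_def right_diff_distrib by linarith
    have "\<alpha> * r \<le> b * r" using that r by (intro mult_right_mono) auto
    then show "B - e + \<alpha> * r \<le> B + b * r" using \<open>e > 0\<close> by linarith
  qed
  have "a \<in> {a..b}" using ab by simp
  have u01: "u0 \<in> periodic_box T R3" "u1 \<in> periodic_box T R3"
    using R1[OF \<open>a \<in> {a..b}\<close> u0(1)] R1[OF \<open>a \<in> {a..b}\<close> u1(1)] low[OF \<open>a \<in> {a..b}\<close>] box13 by fastforce+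
  have main: "\<exists>S \<subseteq> {x \<in> periodic_box T R3. \<forall>t. action_grad \<kappa> (v \<alpha> \<nu>) x t = 0}. card S = 3"
    if \<alpha>: "\<alpha> \<in> {a..b}" and \<nu>: "\<nu> \<in> {0..\<delta>}" for \<alpha> \<nu>
  proof -
    have act: "action T K (V \<alpha> \<nu>) x = f \<alpha> x - \<nu> * h x" for x
      by (simp add: action f_def)
    have close: "\<bar>action T K (V \<alpha> \<nu>) x - f \<alpha> x\<bar> \<le> 1" "\<bar>action T K (V \<alpha> \<nu>) x - f \<alpha> x\<bar> \<le> e / 3"
      if "x \<in> periodic_box T R3" for x
      using pert[OF \<nu> that] unfolding act by auto
    have "\<alpha> * r \<le> b * r" using \<alpha> r by (intro mult_right_mono) auto
    show ?thesis
    \<comment> \<open>The perturbed values at \<open>u0\<close> and \<open>u1\<close> are at most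
      \<open>B + \<alpha> * r - 2 * e / 3\<close>, those on the barrier at least
      \<open>B + \<alpha> * r - e / 3\<close>; the level chosen is the midpoint.\<close>
    proof (rule three_critical_points_action[OF T K V \<Phi> R(1,2), where L = "C + 2" and B = "B + \<alpha> * r - e / 2"
          and r = r and ?u0.0 = u0 and ?u1.0 = u1])
      show "action T K (V \<alpha> \<nu>) x < C + 2" if "x \<in> periodic_box T R1" for x
        using C[OF \<alpha> that] close[of x] box13 that by fastforce
      show "x \<in> periodic_box T R1" if "x \<in> periodic_box T R3" "action T K (V \<alpha> \<nu>) x < B + \<alpha> * r - e / 2" for x
        using close(1)[OF that(1)] that(2) \<open>e > 0\<close> \<open>\<alpha> * r \<le> b * r\<close> box[of R3] that(1)
        by (intro R1[OF \<alpha>]) (auto simp: abs_le_iff)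
      show "x \<in> periodic_box T R2" if "x \<in> periodic_box T R3" "action T K (V \<alpha> \<nu>) x < C + 2" for x
        using close(1)[OF that(1)] that(2) box[of R3] that(1)
        by (intro R2[OF \<alpha>]) (auto simp: abs_le_iff)
      show "action T K (V \<alpha> \<nu>) u0 < B + \<alpha> * r - e / 2" "action T K (V \<alpha> \<nu>) u1 < B + \<alpha> * r - e / 2"
        using close(2)[OF u01(1)] close(2)[OF u01(2)] low[OF \<alpha>] \<open>e > 0\<close> by linarith+
      show "B + \<alpha> * r - e / 2 \<le> action T K (V \<alpha> \<nu>) x" if "x \<in> periodic_box T R3" "\<Phi> x = r" for x
      proof -
        have "f \<alpha> x \<ge> B + \<alpha> * r" using barrier[of x] that box[of R3] by (auto simp: f_def)
        then show ?thesis using close(2)[OF that(1)] \<open>e > 0\<close> by linarith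
      qed
    qed (use u0 u1 u01 in auto)
  qed
  have "\<delta> > 0" using M \<open>e > 0\<close> by (simp add: \<delta>_def)
  then show ?thesis using main by blast
qed

lemma coercive_periodic_sum:
  fixes f g :: "int \<Rightarrow> 'v::euclidean_space \<Rightarrow> 'v \<Rightarrow> real" and T :: int
  assumes T: "T > 0" and "\<alpha> > 0" "s > 0"
    and cont: "\<And>t. t \<in> {1..T} \<Longrightarrow> continuous_on UNIV (\<lambda>(x, y). f t x y)"
      "\<And>t. t \<in> {1..T} \<Longrightarrow> continuous_on UNIV (\<lambda>(x, y). g t x y)"
    and f: "\<forall>t\<in>{1..T}. \<exists>L::ereal. L < \<infinity> \<and>
      ((\<lambda>(x, y). ereal (f t x y / (norm x powr s + norm y powr s))) \<longlongrightarrow> L) norm_sum_infinity"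
    and g: "\<forall>t\<in>{1..T}. filterlim (\<lambda>(x, y). g t x y / (norm x powr s + norm y powr s)) at_top norm_sum_infinity"
  shows "\<exists>R. \<forall>x\<in>periodic_seqs T.
    (\<Sum>t=1..T. \<alpha> * g t (fst (x t)) (snd (x t)) - f t (fst (x t)) (snd (x t))) \<le> C \<longrightarrow> x \<in> periodic_box T R"
proof -
  define k where "k t p = \<alpha> * g t (fst p) (snd p) - f t (fst p) (snd p)" for t p
  have "continuous_on UNIV (k t)" if "t \<in> {1..T}" for t
    using cont[OF that] unfolding k_def case_prod_unfold by (intro continuous_intros)
  moreover have "\<exists>R. \<forall>p. norm p \<ge> R \<longrightarrow> C' \<le> k t p" if t: "t \<in> {1..T}" for t C'
  proof -
    obtain L where L: "L < \<infinity>"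
      "((\<lambda>(x, y). ereal (f t x y / (norm x powr s + norm y powr s))) \<longlongrightarrow> L) norm_sum_infinity"
      using f t by blast
    show ?thesis
      using coercive_difference[OF assms(2,3), of "\<lambda>p. f t (fst p) (snd p)" L "\<lambda>p. g t (fst p) (snd p)" C'] L g t
      by (simp add: k_def case_prod_unfold)
  qed
  ultimately obtain R where R: "\<And>x. (\<Sum>t=1..T. k t (x t)) \<le> C \<Longrightarrow> \<forall>t\<in>{1..T}. norm (x t) \<le> R"
    using coercive_sum[of T k C] by blast
  have "x \<in> periodic_box T R" if "x \<in> periodic_seqs T" "(\<Sum>t=1..T. k t (x t)) \<le> C" for x
    using that R[OF that(2)] periodic_all_iff[OF T that(1), of "\<lambda>y. norm y \<le> R"] by (simp add: periodic_box_def)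
  then show ?thesis unfolding k_def by blast
qed

section \<open>Pairs of sequences as sequences of pairs\<close>

definition pair_of :: "(int \<Rightarrow> 'a \<times> 'b) \<Rightarrow> (int \<Rightarrow> 'a) \<times> (int \<Rightarrow> 'b)" where
  "pair_of x = (\<lambda>t. fst (x t), \<lambda>t. snd (x t))"

lemma pair_of_inverse: "pair_of (\<lambda>t. (fst u t, snd u t)) = u"
  by (simp add: pair_of_def)

lemma inj_pair_of: "inj pair_of"
  by (rule injI) (auto simp: pair_of_def fun_eq_iff prod_eq_iff)

lemma pair_of_in_E_space: "pair_of x \<in> E_space T \<longleftrightarrow> x \<in> periodic_seqs T"
  by (auto simp: pair_of_def E_space_def ET_def periodic_seqs_def prod_eq_iff)

lemma fst_fdiff: "fst (fdiff x t) = fdiff (\<lambda>t. fst (x t)) t"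
  and snd_fdiff: "snd (fdiff x t) = fdiff (\<lambda>t. snd (x t)) t"
  by (simp_all add: fdiff_def)


theorem corollary1p1:
  fixes T :: int
    and \<rho> :: "nat \<Rightarrow> real \<Rightarrow> real"
    and \<phi> :: "nat \<Rightarrow> real ^ 'n::finite \<Rightarrow> real ^ 'n"
    and P :: "nat \<Rightarrow> real ^ 'n \<Rightarrow> real"
    and F G H :: "int \<Rightarrow> real ^ 'n \<Rightarrow> real ^ 'n \<Rightarrow> real"
    and c d m :: "nat \<Rightarrow> real"
    and \<theta> l s :: real
  assumes T: "T > 1"
    and rho_nonneg: "\<forall>i\<in>{1..4}. \<forall>x. \<rho> i x \<ge> 0"
    and rho_periodic: "\<forall>i\<in>{1..4}. \<forall>x. \<rho> i (x + of_int T) = \<rho> i x"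
    and rho_min: "\<forall>i\<in>{1..4}. Min ((\<lambda>t::int. \<rho> i (of_int t)) ` {1..T}) > 0"
    and A1_homeo: "\<forall>i\<in>{1..4}. (\<exists>g. homeomorphism UNIV UNIV (\<phi> i) g) \<and> \<phi> i 0 = 0"
    and A1_grad: "\<forall>i\<in>{1..4}. \<forall>x. GDERIV (P i) x :> \<phi> i x"
    and A1_potential: "\<forall>i\<in>{1..4}. C1_fun (P i) \<and> (\<forall>x. P i x \<ge> 0) \<and> strictly_convex (P i) \<and> P i 0 = 0"
    and A2_periodic: "\<forall>t x y. F (t + T) x y = F t x y \<and> G (t + T) x y = G t x y \<and> H (t + T) x y = H t x y"
    and A2_C1: "\<forall>t\<in>{1..T}. C1_fun (\<lambda>(x, y). F t x y) \<and> C1_fun (\<lambda>(x, y). G t x y) \<and> C1_fun (\<lambda>(x, y). H t x y)"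
    and A3: "\<theta> > 1" "\<forall>i\<in>{1..4}. c i > 0"
      "\<forall>i\<in>{1..4}. \<forall>x y. (\<phi> i x - \<phi> i y) \<bullet> (x - y) \<ge> c i * norm (x - y) powr \<theta>"
    and A4_coercive: "\<forall>i\<in>{1..4}. filterlim (P i) at_top at_infinity"
    and A4: "l \<ge> \<theta>" "\<forall>i\<in>{1..4}. d i > 0 \<and> m i > 0"
      "\<forall>i\<in>{1..4}. \<forall>x. P i x \<le> d i * norm x powr l + m i"
    and A5: "s > l"
      "\<forall>t\<in>{1..T}. filterlim (\<lambda>(x, y). F t x y / (norm x powr l + norm y powr l)) at_top norm_sum_infinity"
      "\<forall>t\<in>{1..T}. \<exists>L::ereal. L < \<infinity> \<and>
         ((\<lambda>(x, y). ereal (F t x y / (norm x powr s + norm y powr s))) \<longlongrightarrow> L) norm_sum_infinity"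
      "\<forall>t\<in>{1..T}. filterlim (\<lambda>(x, y). G t x y / (norm x powr s + norm y powr s)) at_top norm_sum_infinity"
    and A6: "(\<Sum>t=1..T. G t 0 0) = 0"
  shows "\<forall>r>0. \<forall>\<mu>::real. ereal \<mu> > max 0 (mu_star (E_space T) (I_fun T \<rho> P) (Psi_fun T F) (Phi_fun T G) r) \<longrightarrow>
    (\<forall>a b::real. a \<le> b \<and> ereal ` {a..b} \<subseteq>
        {0<..<beta (E_space T) (\<lambda>u. \<mu> * I_fun T \<rho> P u + Psi_fun T F u) (Phi_fun T G) r} \<longrightarrow>
      (\<exists>R>0. \<forall>lam\<in>{a..b}. \<exists>\<delta>>0. \<forall>\<nu>\<in>{0..\<delta>}.
        \<exists>S. card S = 3 \<and> S \<subseteq> {u \<in> E_space T.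
          solves_system \<rho> \<phi> \<mu> (W_fun F G H lam \<nu>) u \<and> norm_E T \<theta> u < R}))"
proof (intro allI impI, elim conjE)
  fix r \<mu> a b :: real
  let ?I = "I_fun T \<rho> P" and ?\<Psi> = "Psi_fun T F" and ?\<Phi> = "Phi_fun T G"
  let ?J = "\<lambda>u. \<mu> * ?I u + ?\<Psi> u"
  assume r: "r > 0" and \<mu>: "ereal \<mu> > max 0 (mu_star (E_space T) ?I ?\<Psi> ?\<Phi> r)"
    and "a \<le> b" and ab: "ereal ` {a..b} \<subseteq> {0<..<beta (E_space T) ?J ?\<Phi> r}"
  have T0: "T > 0" using T by simp
  have "\<mu> > 0" using \<mu> by simp
  have "ereal a \<in> {0<..<beta (E_space T) ?J ?\<Phi> r}" "ereal b \<in> {0<..<beta (E_space T) ?J ?\<Phi> r}"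
    using \<open>a \<le> b\<close> by (intro subsetD[OF ab] imageI; simp)+
  then have "a > 0" and b: "ereal b < beta (E_space T) ?J ?\<Phi> r" by auto

  define gr where "gr k t p = grad (\<lambda>(x, y). k t x y) p" for k :: "int \<Rightarrow> real ^ 'n \<Rightarrow> real ^ 'n \<Rightarrow> real" and t p
  have per: "F \<in> periodic_seqs T" "G \<in> periodic_seqs T" "H \<in> periodic_seqs T"
    using A2_periodic by (auto simp: periodic_seqs_def fun_eq_iff)
  \<comment> \<open>Smoothness is given on one period and reaches all \<open>t\<close> by
    periodicity of the families \<open>F\<close>, \<open>G\<close>, \<open>H\<close>.\<close>
  have C1: "C1_fun (\<lambda>(x, y). F t x y)" "C1_fun (\<lambda>(x, y). G t x y)" "C1_fun (\<lambda>(x, y). H t x y)" for t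
    using periodic_all_iff[OF T0 per(1), of "\<lambda>k. C1_fun (\<lambda>(x, y). k x y)"]
      periodic_all_iff[OF T0 per(2), of "\<lambda>k. C1_fun (\<lambda>(x, y). k x y)"]
      periodic_all_iff[OF T0 per(3), of "\<lambda>k. C1_fun (\<lambda>(x, y). k x y)"] A2_C1 by blast+
  have gr: "GDERIV (\<lambda>p. k t (fst p) (snd p)) p :> gr k t p" "continuous_on UNIV (gr k t)"
    "continuous_on UNIV (\<lambda>p. k t (fst p) (snd p))" if "C1_fun (\<lambda>(x, y). k t x y)" for k t p
  proof -
    show *: "GDERIV (\<lambda>p. k t (fst p) (snd p)) p :> gr k t p" for p
      using C1_fun_grad(1)[OF that] by (simp add: gr_def case_prod_unfold)
    show "continuous_on UNIV (gr k t)"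
      using C1_fun_grad(2)[OF that] by (simp add: gr_def[abs_def])
    show "continuous_on UNIV (\<lambda>p. k t (fst p) (snd p))"
      using GDERIV_isCont[OF *] by (intro continuous_at_imp_continuous_on) auto
  qed
  have gr_per: "gr k \<in> periodic_seqs T" if "k \<in> periodic_seqs T" for k
    using that by (auto simp: periodic_seqs_def gr_def fun_eq_iff)
  have \<rho>_per: "\<rho> i (of_int (t + T)) = \<rho> i (of_int t)" if "i \<in> {1..4}" for i t
    using rho_periodic that by simp
  have \<phi>: "continuous_on UNIV (\<phi> i)" "GDERIV (P i) x :> \<phi> i x" "P i x \<ge> 0" if "i \<in> {1..4}" for i x
    using A1_homeo A1_grad A1_potential that by (auto simp: homeomorphism_def)
  have Pcont: "continuous_on UNIV (P i)" if "i \<in> {1..4}" for i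
    using GDERIV_isCont[OF \<phi>(2)[OF that]] by (intro continuous_at_imp_continuous_on) auto

  \<comment> \<open>A pair of sequences is treated as one sequence in the product space:
    \<open>\<rho> 1\<close> and \<open>\<rho> 2\<close> weight the kinetic part,
    \<open>\<rho> 3\<close> and \<open>\<rho> 4\<close> the potential, from which \<open>W\<close>
    is subtracted.\<close>
  define K where "K t p = \<mu> * (\<rho> 1 (of_int t) * P 1 (fst p) + \<rho> 2 (of_int t) * P 2 (snd p))" for t p
  define \<kappa> where "\<kappa> t p = ((\<mu> * \<rho> 1 (of_int t)) *\<^sub>R \<phi> 1 (fst p), (\<mu> * \<rho> 2 (of_int t)) *\<^sub>R \<phi> 2 (snd p))" for t p
  define V where "V \<alpha> \<nu> t p = \<mu> * (\<rho> 3 (of_int t) * P 3 (fst p) + \<rho> 4 (of_int t) * P 4 (snd p))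
    - W_fun F G H \<alpha> \<nu> t (fst p) (snd p)" for \<alpha> \<nu> t p
  define w where "w \<alpha> \<nu> t p = gr F t p - \<alpha> *\<^sub>R gr G t p + \<nu> *\<^sub>R gr H t p" for \<alpha> \<nu> t p
  define v where "v \<alpha> \<nu> t p = ((\<mu> * \<rho> 3 (of_int t)) *\<^sub>R \<phi> 3 (fst p), (\<mu> * \<rho> 4 (of_int t)) *\<^sub>R \<phi> 4 (snd p))
    - w \<alpha> \<nu> t p" for \<alpha> \<nu> t p
  have w: "GDERIV (\<lambda>p. W_fun F G H \<alpha> \<nu> t (fst p) (snd p)) p :> w \<alpha> \<nu> t p" for \<alpha> \<nu> t p
    unfolding w_def W_fun_def by (intro GDERIV_add GDERIV_diff GDERIV_cmult gr C1)
  have pot: "GDERIV (\<lambda>p. \<mu> * (c * P i (fst p) + d * P j (snd p))) p :> ((\<mu> * c) *\<^sub>R \<phi> i (fst p), (\<mu> * d) *\<^sub>R \<phi> j (snd p))"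
    if "i \<in> {1..4}" "j \<in> {1..4}" for c d i j p
  proof -
    have "GDERIV (\<lambda>p. \<mu> * (c * P i (fst p) + d * P j (snd p))) p :>
      \<mu> *\<^sub>R (c *\<^sub>R (\<phi> i (fst p), 0) + d *\<^sub>R (0, \<phi> j (snd p)))"
      by (intro GDERIV_cmult GDERIV_add GDERIV_fst GDERIV_snd \<phi> that)
    then show ?thesis by simp
  qed
  have K: "GDERIV (K t) p :> \<kappa> t p" for t p
    unfolding K_def \<kappa>_def by (intro pot) auto
  have V: "GDERIV (V \<alpha> \<nu> t) p :> v \<alpha> \<nu> t p" for \<alpha> \<nu> t p
    unfolding V_def v_def by (intro GDERIV_diff pot w) auto
  have \<phi>_comp: "continuous_on UNIV (\<lambda>p. \<phi> i (fst p))" "continuous_on UNIV (\<lambda>p. \<phi> i (snd p))" if "i \<in> {1..4}" for i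
    by (intro continuous_on_compose2[OF \<phi>(1)[OF that]] continuous_intros; simp)+
  have \<kappa>_cont: "continuous_on UNIV (\<kappa> t)" for t
    unfolding \<kappa>_def by (intro continuous_intros \<phi>_comp) auto
  have v_cont: "continuous_on UNIV (v \<alpha> \<nu> t)" for \<alpha> \<nu> t
    unfolding v_def w_def by (intro continuous_intros \<phi>_comp gr C1) auto
  have \<kappa>_per: "\<kappa> \<in> periodic_seqs T" and v_per: "v \<alpha> \<nu> \<in> periodic_seqs T" for \<alpha> \<nu>
    using \<rho>_per gr_per[OF per(1)] gr_per[OF per(2)] gr_per[OF per(3)]
    by (auto simp: periodic_seqs_def \<kappa>_def v_def w_def fun_eq_iff simp del: of_int_add)
  have action: "action T K (V \<alpha> \<nu>) x = ?J (pair_of x) + \<alpha> * ?\<Phi> (pair_of x) - \<nu> * Phi_fun T H (pair_of x)" for \<alpha> \<nu> x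
    unfolding action_def I_fun_def Psi_fun_def Phi_fun_def K_def V_def W_fun_def sum_distrib_left
      sum_negf[symmetric] sum.distrib[symmetric] sum_subtractf[symmetric]
    by (intro sum.cong) (auto simp: pair_of_def fst_fdiff snd_fdiff algebra_simps)

  have coord: "continuous_on UNIV (\<lambda>x :: int \<Rightarrow> (real ^ 'n) \<times> (real ^ 'n). x t)" for t
    by (rule continuous_on_product_coordinates)
  have Phi_cont: "continuous_on UNIV (\<lambda>x. Phi_fun T k (pair_of x))" if "\<And>t. C1_fun (\<lambda>(x, y). k t x y)"
    for k :: "int \<Rightarrow> real ^ 'n \<Rightarrow> real ^ 'n \<Rightarrow> real"
    unfolding Phi_fun_def pair_of_def fst_conv snd_conv
    by (intro continuous_on_sum continuous_on_compose2[OF gr(3)[OF that] coord]) auto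
  have J_cont: "continuous_on UNIV (\<lambda>x. ?J (pair_of x))"
  proof -
    \<comment> \<open>For \<open>\<alpha> = \<nu> = 0\<close> the action is \<open>J\<close>
      itself.\<close>
    have "continuous_on UNIV (action T K (V 0 0))"
      using GDERIV_isCont[OF K] GDERIV_isCont[OF V]
      by (intro continuous_on_action continuous_at_imp_continuous_on) auto
    moreover have "action T K (V 0 0) = (\<lambda>x. ?J (pair_of x))"
      by (rule ext) (simp add: action)
    ultimately show ?thesis by metis
  qed
  have I_nonneg: "?I u \<ge> 0" for u
    unfolding I_fun_def using rho_nonneg \<phi>(3)
    by (intro sum_nonneg add_nonneg_nonneg mult_nonneg_nonneg) auto
  have coercive: "\<exists>R. \<forall>x\<in>periodic_seqs T. ?J (pair_of x) + \<alpha> * ?\<Phi> (pair_of x) \<le> C \<longrightarrow> x \<in> periodic_box T R"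
    if "\<alpha> > 0" for \<alpha> C
  proof -
    have "s > 0" using A3 A4 A5 by linarith
    have FG_cont: "continuous_on UNIV (\<lambda>(x, y). F t x y)" "continuous_on UNIV (\<lambda>(x, y). G t x y)" for t
      using gr(3)[of F t] gr(3)[of G t] C1 by (simp_all add: case_prod_unfold)
    obtain R where R: "\<forall>x\<in>periodic_seqs T.
      (\<Sum>t=1..T. \<alpha> * G t (fst (x t)) (snd (x t)) - F t (fst (x t)) (snd (x t))) \<le> C \<longrightarrow> x \<in> periodic_box T R"
      using coercive_periodic_sum[OF T0 \<open>\<alpha> > 0\<close> \<open>s > 0\<close> FG_cont A5(3,4), of C] by blast
    \<comment> \<open>\<open>\<mu> I\<close> is nonnegative; dropping it leaves a smaller functional
      that is already coercive by the growth of order \<open>s\<close>.\<close>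
    have "(\<Sum>t=1..T. \<alpha> * G t (fst (x t)) (snd (x t)) - F t (fst (x t)) (snd (x t)))
      \<le> ?J (pair_of x) + \<alpha> * ?\<Phi> (pair_of x)" for x
      using mult_nonneg_nonneg[OF less_imp_le[OF \<open>\<mu> > 0\<close>] I_nonneg[of "pair_of x"]]
      by (simp add: Psi_fun_def Phi_fun_def pair_of_def sum_subtractf sum_distrib_left)
    from order_trans[OF this] show ?thesis using R by blast
  qed

  obtain u0 B where u0: "u0 \<in> E_space T" "?\<Phi> u0 < r" "?J u0 < B"
    and barrier: "\<And>u. u \<in> E_space T \<Longrightarrow> ?\<Phi> u = r \<Longrightarrow> B \<le> ?J u"
    using mu_star_barrier[OF \<open>\<mu> > 0\<close>, of "E_space T" ?I ?\<Psi> ?\<Phi> r] \<mu> by auto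
  obtain u1 where u1: "u1 \<in> E_space T" "r < ?\<Phi> u1" "?J u1 + b * (?\<Phi> u1 - r) \<le> ?J u0"
    using beta_witness[OF b u0(1,2)] by blast
  obtain R \<delta> where "\<delta> > 0" and three: "\<forall>\<alpha>\<in>{a..b}. \<forall>\<nu>\<in>{0..\<delta>}.
      \<exists>S \<subseteq> {x \<in> periodic_box T R. \<forall>t. action_grad \<kappa> (v \<alpha> \<nu>) x t = 0}. card S = 3"
  proof -
    let ?x0 = "\<lambda>t. (fst u0 t, snd u0 t)" and ?x1 = "\<lambda>t. (fst u1 t, snd u1 t)"
    have "\<exists>R \<delta>. \<delta> > 0 \<and> (\<forall>\<alpha>\<in>{a..b}. \<forall>\<nu>\<in>{0..\<delta>}.
      \<exists>S \<subseteq> {x \<in> periodic_box T R. \<forall>t. action_grad \<kappa> (v \<alpha> \<nu>) x t = 0}. card S = 3)"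
    proof (rule three_critical_points_uniform[OF T0 K \<kappa>_cont \<kappa>_per V v_cont v_per action J_cont
          Phi_cont[OF C1(2)] Phi_cont[OF C1(3)] coercive \<open>a > 0\<close> \<open>a \<le> b\<close> r, where ?u0.0 = ?x0 and ?u1.0 = ?x1 and B = B])
      show "?x0 \<in> periodic_seqs T" "?x1 \<in> periodic_seqs T"
        using u0(1) u1(1) by (simp_all add: pair_of_in_E_space[symmetric] pair_of_inverse)
      show "B \<le> ?J (pair_of x)" if "x \<in> periodic_seqs T" "?\<Phi> (pair_of x) = r" for x
        using barrier that by (simp add: pair_of_in_E_space)
    qed (use u0 u1 in \<open>simp_all add: pair_of_inverse\<close>)
    then show thesis using that by blast
  qed
  have "\<theta> > 0" using A3(1) by simp
  then obtain R' where R': "R' > 0" "\<And>u :: 'n seq \<times> 'n seq.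
      (\<forall>t. norm (fst u t) \<le> R \<and> norm (snd u t) \<le> R) \<Longrightarrow> norm_E T \<theta> u < R'"
    using norm_E_bounded[where 'n = 'n, of \<theta> R T] by blast
  have solution: "pair_of x \<in> {u \<in> E_space T. solves_system \<rho> \<phi> \<mu> (W_fun F G H \<alpha> \<nu>) u \<and> norm_E T \<theta> u < R'}"
    if x: "x \<in> periodic_box T R" "\<And>t. action_grad \<kappa> (v \<alpha> \<nu>) x t = 0" for x \<alpha> \<nu>
  proof (intro CollectI conjI)
    show "pair_of x \<in> E_space T"
      using x(1) by (simp add: pair_of_in_E_space periodic_box_def)
    have "norm (x t) \<le> R" for t using x(1) by (simp add: periodic_box_def)
    then have "norm (fst (x t)) \<le> R" "norm (snd (x t)) \<le> R" for t
      using order_trans[OF norm_fst_le[of "fst (x t)" "snd (x t)"]]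
        order_trans[OF norm_snd_le[of "snd (x t)" "fst (x t)"]] by simp_all
    then show "norm_E T \<theta> (pair_of x) < R'"
      by (intro R'(2)) (simp add: pair_of_def)
    have grad: "grad (\<lambda>y. W_fun F G H \<alpha> \<nu> t y (snd (x t))) (fst (x t)) = fst (w \<alpha> \<nu> t (x t))"
      "grad (\<lambda>y. W_fun F G H \<alpha> \<nu> t (fst (x t)) y) (snd (x t)) = snd (w \<alpha> \<nu> t (x t))" for t
      using GDERIV_section1[OF w[of \<alpha> \<nu> t "(fst (x t), snd (x t))"]]
        GDERIV_section2[OF w[of \<alpha> \<nu> t "(fst (x t), snd (x t))"]]
      by (auto intro!: grad_eqI)
    show "solves_system \<rho> \<phi> \<mu> (W_fun F G H \<alpha> \<nu>) (pair_of x)"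
      unfolding solves_system_def
    proof (intro allI)
      fix t
      \<comment> \<open>The two components of the gradient are the left sides of the two equations
        with opposite sign.\<close>
      have eq: "fst (action_grad \<kappa> (v \<alpha> \<nu>) x t) = 0" "snd (action_grad \<kappa> (v \<alpha> \<nu>) x t) = 0"
        using x(2)[of t] by simp_all
      show "\<mu> *\<^sub>R fdiff (\<lambda>s. \<rho> 1 (of_int (s - 1)) *\<^sub>R \<phi> 1 (fdiff (fst (pair_of x)) (s - 1))) t
         - (\<mu> * \<rho> 3 (of_int t)) *\<^sub>R \<phi> 3 (fst (pair_of x) t)
         + grad (\<lambda>y. W_fun F G H \<alpha> \<nu> t y (snd (pair_of x) t)) (fst (pair_of x) t) = 0 \<and>
       \<mu> *\<^sub>R fdiff (\<lambda>s. \<rho> 2 (of_int (s - 1)) *\<^sub>R \<phi> 2 (fdiff (snd (pair_of x)) (s - 1))) t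
         - (\<mu> * \<rho> 4 (of_int t)) *\<^sub>R \<phi> 4 (snd (pair_of x) t)
         + grad (\<lambda>y. W_fun F G H \<alpha> \<nu> t (fst (pair_of x) t) y) (snd (pair_of x) t) = 0"
        using eq by (simp add: pair_of_def grad action_grad_def \<kappa>_def v_def fdiff_def algebra_simps)
    qed
  qed
  have "\<exists>S. card S = 3 \<and> S \<subseteq> {u \<in> E_space T.
      solves_system \<rho> \<phi> \<mu> (W_fun F G H \<alpha> \<nu>) u \<and> norm_E T \<theta> u < R'}"
    if "\<alpha> \<in> {a..b}" "\<nu> \<in> {0..\<delta>}" for \<alpha> \<nu>
  proof -
    obtain S where S: "S \<subseteq> {x \<in> periodic_box T R. \<forall>t. action_grad \<kappa> (v \<alpha> \<nu>) x t = 0}" "card S = 3"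
      using three \<open>\<alpha> \<in> {a..b}\<close> \<open>\<nu> \<in> {0..\<delta>}\<close> by blast
    have "card (pair_of ` S) = 3"
      using S(2) card_image[OF inj_on_subset[OF inj_pair_of, of S]] by simp
    moreover have "pair_of ` S \<subseteq> {u \<in> E_space T. solves_system \<rho> \<phi> \<mu> (W_fun F G H \<alpha> \<nu>) u \<and> norm_E T \<theta> u < R'}"
      using S(1) solution by blast
    ultimately show ?thesis by blast
  qed
  \<comment> \<open>The same \<open>\<delta>\<close> serves every \<open>lam\<close>, which is more
    than the order of quantifiers asks.\<close>
  then show "\<exists>R>0. \<forall>lam\<in>{a..b}. \<exists>\<delta>>0. \<forall>\<nu>\<in>{0..\<delta>}. \<exists>S. card S = 3 \<and> S \<subseteq> {u \<in> E_space T.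
    solves_system \<rho> \<phi> \<mu> (W_fun F G H lam \<nu>) u \<and> norm_E T \<theta> u < R}"
    using R'(1) \<open>\<delta> > 0\<close> by meson
qed

end
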